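(* Let $1\le p<\infty$, $0<\theta_2<\infty$ and $\omega\in A^{\rho,\theta_2}_p(\mathbb R^d)$. Let $N_0$ and $\eta=\eta(\omega)$ be the constants fixed in the context. Then the following statements are true. (1) Let $0<\theta_1<\infty$. There is a constant $C>0$, independent of $f$ and $\mathcal Q$, such that for every $f\in \mathrm{BMO}_{\rho,\theta_1}(\mathbb R^d)$ and every cube $\mathcal Q=Q(x_0,r)\subset\mathbb R^d$, $$\bigg(\frac{1}{\omega(\mathcal Q)}\int_{\mathcal Q}|f(x)-f_{\mathcal Q}|^p\,\omega(x)\,dx\bigg)^{1/p}\le C\bigg(1+\frac{r}{\rho(x_0)}\bigg)^{(N_0+1)\theta_1+\eta/p}\|f\|_{\mathrm{BMO}_{\rho,\theta_1}}.$$ (2) Conversely, let $f\in L^1_{\mathrm{loc}}(\mathbb R^d)$ be real-valued. If there exist a constant $C>0$ and some $\theta_1>0$ such that for every cube $\mathcal Q=Q(x_0,r)\subset\mathbb R^d$, $$\bigg(\frac{1}{\omega(\mathcal Q)}\int_{\mathcal Q}|f(x)-f_{\mathcal Q}|^p\,\omega(x)\,dx\bigg)^{1/p}\le C\bigg(1+\frac{r}{\rho(x_0)}\bigg)^{\theta_1-\theta_2},$$ then $f\in \mathrm{BMO}_{\rho,\theta_1}(\mathbb R^d)$ and $$\|f\|_{\mathrm{BMO}_{\rho,\theta_1}}\le C'\,[\omega]_{A^{\rho,\theta_2}_p},$$ where $C'>0$ depends only on $C,d,p,\theta_1,\theta_2$.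
   Context: Setting: $d\ge 3$, and $V:\mathbb R^d\to[0,\infty)$ is locally integrable, not identically zero, and belongs to the reverse Hölder class $RH_s(\mathbb R^d)$ for some $s\ge d/2$, i.e. there is a constant $C>0$ with $\big(\frac1{|B|}\int_B V^s\big)^{1/s}\le C\,\frac1{|B|}\int_B V$ for every ball $B$ (usual modification if $s=\infty$). $B(x,r)$ is the open ball with center $x$ and radius $r$. The critical radius function is $$\rho(x):=\sup\Big\{r>0:\ \frac{1}{r^{d-2}}\int_{B(x,r)}V(y)\,dy\le 1\Big\},\qquad x\in\mathbb R^d,$$ which satisfies $0<\rho(x)<\infty$. Constant $N_0$: it is known (Shen) that there are constants $C_0\ge1$, $N_0>0$ such that for all $x,y\in\mathbb R^d$ $$\frac1{C_0}\Big(1+\frac{|x-y|}{\rho(x)}\Big)^{-N_0}\le\frac{\rho(y)}{\rho(x)}\le C_0\Big(1+\frac{|x-y|}{\rho(x)}\Big)^{\frac{N_0}{N_0+1}};$$ such constants are fixed. Cubes: $Q(x_0,r)$ is the cube centered at $x_0$ with sidelength $r$ and sides parallel to the axes. $f_{\mathcal Q}:=\frac1{|\mathcal Q|}\int_{\mathcal Q}f$. Weights: a weight is a nonnegative locally integrable function $\omega$ on $\mathbb R^d$, not a.e. zero; $\omega(E):=\int_E\omega(x)\,dx$. Let $p'$ denote the conjugate exponent, $1/p+1/p'=1$. For $0<\theta<\infty$ and $1<p<\infty$, $\omega\in A_p^{\rho,\theta}(\mathbb R^d)$ means $[\omega]_{A_p^{\rho,\theta}}<\infty$, where $$[\omega]_{A^{\rho,\theta}_p}:=\sup_{B=B(x_0,r)}\Big(1+\frac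 r{\rho(x_0)}\Big)^{-\theta}\Big(\frac1{|B|}\int_B\omega\Big)^{1/p}\Big(\frac1{|B|}\int_B\omega^{-p'/p}\Big)^{1/p'},$$ and $\omega\in A_1^{\rho,\theta}(\mathbb R^d)$ means $[\omega]_{A_1^{\rho,\theta}}:=\sup_{B=B(x_0,r)}\big(1+\frac r{\rho(x_0)}\big)^{-\theta}\big(\frac1{|B|}\int_B\omega\big)\big(\operatorname{ess\,inf}_{B}\omega\big)^{-1}<\infty$. (Balls may be replaced by cubes in these definitions, giving the same classes.) Constant $\eta$: it is known (Bongioanni–Harboure–Salinas) that if $\omega\in A_p^{\rho,\theta}(\mathbb R^d)$ with $1\le p<\infty$, $0<\theta<\infty$, then there exist $\epsilon>0$, $\eta>1$, $C>0$ such that for every cube $\mathcal Q=Q(x_0,r)$ $$\Big(\frac1{|\mathcal Q|}\int_{\mathcal Q}\omega^{1+\epsilon}\Big)^{\frac1{1+\epsilon}}\le C\Big(\frac1{|\mathcal Q|}\int_{\mathcal Q}\omega\Big)\Big(1+\frac r{\rho(x_0)}\Big)^{\eta}.$$ $\eta=\eta(\omega)$ denotes such an exponent, fixed for $\omega$. BMO: for $0<\theta<\infty$, $\mathrm{BMO}_{\rho,\theta}(\mathbb R^d)$ is the set of real-valued $f\in L^1_{\mathrm{loc}}(\mathbb R^d)$ with $$\|f\|_{\mathrm{BMO}_{\rho,\theta}}:=\sup_{Q=Q(x_0,r)}\Big(1+\frac r{\rho(x_0)}\Big)^{-\theta}\frac1{|Q|}\int_Q|f(x)-f_Q|\,dx<\infty,$$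 the supremum being over all cubes $Q(x_0,r)$, $x_0\in\mathbb R^d$, $r>0$. *)

theory Defs
  imports "HOL-Analysis.Analysis" "HOL-Probability.Essential_Supremum"
begin

text \<open>All averages, weighted integrals and suprema are taken in \<^typ>\<open>ennreal\<close>, so that a divergent
  integral or an unbounded supremum has the value \<open>\<infinity>\<close> and not the junk value \<open>0\<close>. Functions on
  \<open>real ^ 'n\<close> are merely Lebesgue measurable, hence \<^term>\<open>lebesgue\<close>.\<close>

text \<open>Real powers on \<open>[0,\<infinity>]\<close> for a nonzero exponent. In particular \<open>epowr 0 t = \<infinity>\<close> for \<open>t < 0\<close>,
  whereas \<open>0 powr t = 0\<close> on the reals.\<close>

definition epowr :: "ennreal \<Rightarrow> real \<Rightarrow> ennreal" where
  "epowr a t =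
    (let b = (if a = \<infinity> then \<infinity> else ennreal (enn2real a powr \<bar>t\<bar>))
     in if t < 0 then inverse b else b)"

text \<open>The cube has sidelength \<open>r\<close>, not half-sidelength \<open>r\<close>. It is taken closed; its boundary is a
  null set.\<close>

definition cube :: "real ^ 'n \<Rightarrow> real \<Rightarrow> (real ^ 'n) set" where
  "cube x r = cbox (x - vec (r / 2)) (x + vec (r / 2))"

definition locally_integrable :: "(real ^ 'n \<Rightarrow> real) \<Rightarrow> bool" where
  "locally_integrable f \<longleftrightarrow> (\<forall>K. compact K \<longrightarrow> f absolutely_integrable_on K)"

definition eavg :: "(real ^ 'n) set \<Rightarrow> (real ^ 'n \<Rightarrow> ennreal) \<Rightarrow> ennreal" where
  "eavg A g = (\<integral>\<^sup>+y\<in>A. g y \<partial>lebesgue) / emeasure lebesgue A"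

definition mean :: "(real ^ 'n) set \<Rightarrow> (real ^ 'n \<Rightarrow> real) \<Rightarrow> real" where
  "mean A f = (LINT y:A|lebesgue. f y) / measure lebesgue A"

definition ess_inf_on :: "(real ^ 'n) set \<Rightarrow> (real ^ 'n \<Rightarrow> ennreal) \<Rightarrow> ennreal" where
  "ess_inf_on A g = Sup {c. AE y\<in>A in lebesgue. c \<le> g y}"

definition reverse_Hoelder_class :: "ennreal \<Rightarrow> (real ^ 'n \<Rightarrow> real) set" where
  "reverse_Hoelder_class s = {V. \<exists>C>0. \<forall>x. \<forall>r>0.
     (if s = \<infinity> then esssup (lebesgue_on (ball x r)) (\<lambda>y. ennreal (V y))
      else epowr (eavg (ball x r) (\<lambda>y. epowr (ennreal (V y)) (enn2real s))) (1 / enn2real s))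
     \<le> ennreal C * eavg (ball x r) (\<lambda>y. ennreal (V y))}"

text \<open>The potential must not vanish almost everywhere: otherwise the critical radius would be
  infinite.\<close>

definition admissible_potential :: "(real ^ 'n \<Rightarrow> real) \<Rightarrow> bool" where
  "admissible_potential V \<longleftrightarrow>
     (\<forall>x. 0 \<le> V x) \<and> locally_integrable V \<and> \<not> (AE x in lebesgue. V x = 0) \<and>
     (\<exists>s. ennreal (real CARD('n) / 2) \<le> s \<and> V \<in> reverse_Hoelder_class s)"

text \<open>The supremum is formed in \<open>[0,\<infinity>]\<close>, where it always exists. For an admissible potential in
  dimension at least \<open>3\<close> it lies in \<open>(0,\<infinity>)\<close>, so \<^const>\<open>enn2real\<close> loses nothing.\<close>

definition critical_radius :: "(real ^ 'n \<Rightarrow> real) \<Rightarrow> real ^ 'n \<Rightarrow> real" where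
  "critical_radius V x = enn2real (Sup (ennreal `
     {r. 0 < r \<and>
         ennreal (1 / r ^ (CARD('n) - 2)) * (\<integral>\<^sup>+y\<in>ball x r. ennreal (V y) \<partial>lebesgue) \<le> 1}))"

definition Shen_constants :: "(real ^ 'n \<Rightarrow> real) \<Rightarrow> real \<Rightarrow> real \<Rightarrow> bool" where
  "Shen_constants \<rho> C0 N0 \<longleftrightarrow> 1 \<le> C0 \<and> 0 < N0 \<and>
     (\<forall>x y. 1 / C0 * (1 + norm (x - y) / \<rho> x) powr (- N0) \<le> \<rho> y / \<rho> x \<and>
            \<rho> y / \<rho> x \<le> C0 * (1 + norm (x - y) / \<rho> x) powr (N0 / (N0 + 1)))"

definition weight :: "(real ^ 'n \<Rightarrow> real) \<Rightarrow> bool" where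
  "weight \<omega> \<longleftrightarrow>
     (\<forall>x. 0 \<le> \<omega> x) \<and> locally_integrable \<omega> \<and> \<not> (AE x in lebesgue. \<omega> x = 0)"

definition wmeasure :: "(real ^ 'n \<Rightarrow> real) \<Rightarrow> (real ^ 'n) set \<Rightarrow> ennreal" where
  "wmeasure \<omega> E = (\<integral>\<^sup>+x\<in>E. ennreal (\<omega> x) \<partial>lebesgue)"

text \<open>In \<^typ>\<open>ennreal\<close> one has \<open>0 * \<infinity> = 0\<close>, so a ball on which \<open>\<omega>\<close> vanishes a.e. contributes \<open>0\<close>.
  Since a weight is not a.e. zero, larger balls still make the supremum infinite if \<open>\<omega>\<close> vanishes
  on a set of positive measure.\<close>

definition Ap_const :: "(real ^ 'n \<Rightarrow> real) \<Rightarrow> real \<Rightarrow> real \<Rightarrow> (real ^ 'n \<Rightarrow> real) \<Rightarrow> ennreal" where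
  "Ap_const \<rho> \<theta> p \<omega> = (SUP x. SUP r\<in>{0<..}.
     ennreal ((1 + r / \<rho> x) powr (- \<theta>)) *
     (if p = 1
      then eavg (ball x r) (\<lambda>y. ennreal (\<omega> y)) * inverse (ess_inf_on (ball x r) (\<lambda>y. ennreal (\<omega> y)))
      else let p' = p / (p - 1) in
        epowr (eavg (ball x r) (\<lambda>y. ennreal (\<omega> y))) (1 / p) *
        epowr (eavg (ball x r) (\<lambda>y. epowr (ennreal (\<omega> y)) (- p' / p))) (1 / p')))"

definition Ap_class :: "(real ^ 'n \<Rightarrow> real) \<Rightarrow> real \<Rightarrow> real \<Rightarrow> (real ^ 'n \<Rightarrow> real) set" where
  "Ap_class \<rho> \<theta> p = {\<omega>. weight \<omega> \<and> Ap_const \<rho> \<theta> p \<omega> < \<infinity>}"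

definition reverse_Hoelder_exponent ::
  "(real ^ 'n \<Rightarrow> real) \<Rightarrow> (real ^ 'n \<Rightarrow> real) \<Rightarrow> real \<Rightarrow> bool" where
  "reverse_Hoelder_exponent \<rho> \<omega> \<eta> \<longleftrightarrow> 1 < \<eta> \<and>
     (\<exists>\<epsilon>>0. \<exists>C>0. \<forall>x. \<forall>r>0.
        epowr (eavg (cube x r) (\<lambda>y. epowr (ennreal (\<omega> y)) (1 + \<epsilon>))) (1 / (1 + \<epsilon>))
        \<le> ennreal C * eavg (cube x r) (\<lambda>y. ennreal (\<omega> y)) * ennreal ((1 + r / \<rho> x) powr \<eta>))"

definition BMO_norm :: "(real ^ 'n \<Rightarrow> real) \<Rightarrow> real \<Rightarrow> (real ^ 'n \<Rightarrow> real) \<Rightarrow> ennreal" where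
  "BMO_norm \<rho> \<theta> f = (SUP x. SUP r\<in>{0<..}.
     ennreal ((1 + r / \<rho> x) powr (- \<theta>)) *
     eavg (cube x r) (\<lambda>y. ennreal \<bar>f y - mean (cube x r) f\<bar>))"

definition BMO :: "(real ^ 'n \<Rightarrow> real) \<Rightarrow> real \<Rightarrow> (real ^ 'n \<Rightarrow> real) set" where
  "BMO \<rho> \<theta> = {f. locally_integrable f \<and> BMO_norm \<rho> \<theta> f < \<infinity>}"

definition weighted_oscillation ::
  "real \<Rightarrow> (real ^ 'n \<Rightarrow> real) \<Rightarrow> (real ^ 'n \<Rightarrow> real) \<Rightarrow> (real ^ 'n) set \<Rightarrow> ennreal" where
  "weighted_oscillation p \<omega> f Q =
     epowr ((\<integral>\<^sup>+x\<in>Q. ennreal (\<bar>f x - mean Q f\<bar> powr p * \<omega> x) \<partial>lebesgue) / wmeasure \<omega> Q) (1 / p)"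

end

theory Submission
  imports Defs
begin

text \<open>Both parts compare, on one cube \<open>Q\<close> at a time, an unweighted with a weighted mean oscillation,
  and Hoelder's inequality does the comparison.

  For the first part, Hoelder's inequality with the exponents \<open>(1 + \<epsilon>) / \<epsilon>\<close> and \<open>1 + \<epsilon>\<close> splits the
  integral of \<open>\<bar>f - f\<^sub>Q\<bar> powr p * \<omega>\<close>. The reverse Hoelder inequality controls the factor with the
  weight, so that an unweighted moment of \<open>\<bar>f - f\<^sub>Q\<bar>\<close> is left
  (\<open>weighted_oscillation_le_moment\<close>). On every subcube of \<open>Q = Q(x, r)\<close> the mean oscillation of
  \<open>f\<close> is at most a constant times \<open>M = (1 + r / \<rho> x) powr ((N0 + 1) * \<theta>) * \<parallel>f\<parallel>\<close>, because by Shen's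
  inequality the critical radius cannot be much smaller elsewhere in \<open>Q\<close> than at \<open>x\<close>
  (\<open>Shen_constants_subcube\<close>); this is where the factor \<open>N0 + 1\<close> comes from. So \<open>f\<close> is an ordinary
  function of bounded mean oscillation inside \<open>Q\<close>, and the John--Nirenberg inequality bounds all its
  moments by powers of \<open>M\<close>.

  The John--Nirenberg inequality is proved here by dyadic stopping. Suppose that on each subcube the
  oscillation exceeds a level \<open>t\<close> on at most the fraction \<open>\<beta>\<close>. Bisect \<open>Q\<close> repeatedly and stop at a
  subcube as soon as its mean differs from \<open>f\<^sub>Q\<close> by more than \<open>2 * M\<close>. The stopped cubes fill at most
  half of \<open>Q\<close>, their means are still within \<open>(2 + 2 ^ n) * M\<close> of \<open>f\<^sub>Q\<close>, and in each of them the
  hypothesis applies again; so the level \<open>t + (2 + 2 ^ n) * M\<close> is exceeded on at most the fraction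
  \<open>\<beta> / 2\<close>. Outside the stopped cubes \<open>f\<close> is close to its means on small cubes. Instead of Lebesgue's
  differentiation theorem this uses only that \<open>f\<close> is a limit of continuous functions in the mean:
  after finitely many bisections the exceptional set has small measure, which suffices because the
  bound is needed up to an arbitrary error.

  For the second part, Hoelder's inequality is applied to \<open>\<bar>f - f\<^sub>Q\<bar> * \<omega> powr (1 / p)\<close> and
  \<open>\<omega> powr (- 1 / p)\<close>, which turns the oscillation into the weighted one times the \<open>A\<^sub>p\<close> quantity of
  \<open>Q\<close>; that quantity is compared with the one of a ball around \<open>Q\<close> of comparable volume
  (\<open>oscillation_le_Ap_ratio\<close>). The division by the weight is legitimate because a weight with finite
  \<open>A\<^sub>p\<close> constant is positive almost everywhere (\<open>Ap_class_AE_pos\<close>).\<close>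

section \<open>Powers and Hoelder's inequality on \<open>[0,\<infinity>]\<close>\<close>

lemma ennreal_divide_mult_cancel: "0 < c \<Longrightarrow> a / ennreal c * ennreal c = a"
  by (simp add: divide_ennreal_def mult.assoc inverse_ennreal flip: ennreal_mult)

lemma epowr_ennreal: "0 < t \<Longrightarrow> 0 \<le> a \<Longrightarrow> epowr (ennreal a) t = ennreal (a powr t)"
  by (simp add: epowr_def)

lemma epowr_top: "0 < t \<Longrightarrow> epowr \<infinity> t = \<infinity>"
  by (simp add: epowr_def)

lemma epowr_one: "epowr a 1 = a"
  by (cases a) (simp_all add: epowr_def)

lemma epowr_zero: "0 < t \<Longrightarrow> epowr 0 t = 0"
  by (simp add: epowr_def)

lemma epowr_neg:
  assumes "0 < t" "0 < a" shows "epowr (ennreal a) (- t) = ennreal (a powr (- t))"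
  using assms by (simp add: epowr_def powr_minus inverse_ennreal)

lemma epowr_mono:
  assumes "0 < t" "a \<le> b" shows "epowr a t \<le> epowr b t"
  using assms
  by (cases a; cases b) (auto simp: epowr_ennreal epowr_top[unfolded infinity_ennreal_def] top_unique intro!: ennreal_leI powr_mono2)

lemma epowr_mult:
  assumes "0 < t" shows "epowr (a * b) t = epowr a t * epowr b t"
proof -
  have *: "epowr (\<infinity> * c) t = epowr \<infinity> t * epowr c t" for c
  proof (cases c)
    case (real r)
    then show ?thesis using assms
      by (cases "r = 0") (auto simp: epowr_top[unfolded infinity_ennreal_def] epowr_zero ennreal_top_mult epowr_ennreal)
  qed (use assms in \<open>auto simp: epowr_top[unfolded infinity_ennreal_def]\<close>)
  show ?thesis
  proof (cases "a = \<infinity> \<or> b = \<infinity>")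
    case True then show ?thesis using *[of b] *[of a] by (auto simp: mult.commute)
  next
    case False
    then obtain r s where "a = ennreal r" "b = ennreal s" "0 \<le> r" "0 \<le> s"
      by (cases a; cases b) auto
    then show ?thesis using assms
      by (simp add: epowr_ennreal powr_mult flip: ennreal_mult)
  qed
qed

lemma Hoelder_nn_integral:
  fixes u v :: "'a \<Rightarrow> real"
  assumes [measurable]: "u \<in> borel_measurable M" "v \<in> borel_measurable M"
    and nonneg: "\<And>x. 0 \<le> u x" "\<And>x. 0 \<le> v x"
    and ab: "1 < a" "1 < b" "1 / a + 1 / b = 1"
  shows "(\<integral>\<^sup>+x. ennreal (u x * v x) \<partial>M)
     \<le> epowr (\<integral>\<^sup>+x. ennreal (u x powr a) \<partial>M) (1 / a) * epowr (\<integral>\<^sup>+x. ennreal (v x powr b) \<partial>M) (1 / b)"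
    (is "_ \<le> epowr ?A _ * epowr ?B _")
proof -
  have zero: "(\<integral>\<^sup>+x. ennreal (u x * v x) \<partial>M) = 0" if "?A = 0 \<or> ?B = 0"
  proof -
    have "AE x in M. u x * v x = 0"
      using that
    proof
      assume "?A = 0"
      then have "AE x in M. u x powr a = 0"
        by (subst (asm) nn_integral_0_iff_AE) (auto simp: ennreal_eq_0_iff powr_def split: if_splits)
      then show ?thesis by eventually_elim (auto)
    next
      assume "?B = 0"
      then have "AE x in M. v x powr b = 0"
        by (subst (asm) nn_integral_0_iff_AE) (auto simp: ennreal_eq_0_iff powr_def split: if_splits)
      then show ?thesis by eventually_elim (auto)
    qed
    then show ?thesis by (subst nn_integral_0_iff_AE) auto
  qed
  show ?thesis
  proof (cases "?A = 0 \<or> ?B = 0")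
    case True then show ?thesis using zero by simp
  next
    case nz: False
    show ?thesis
    proof (cases "?A = \<infinity> \<or> ?B = \<infinity>")
      case True
      have pos: "epowr c t \<noteq> 0" if "c \<noteq> 0" "0 < t" for c t
        using that by (cases c) (auto simp: epowr_ennreal epowr_top[unfolded infinity_ennreal_def] ennreal_eq_0_iff powr_def split: if_splits)
      have "epowr ?A (1 / a) * epowr ?B (1 / b) = \<infinity>"
        using True nz ab pos[of ?A "1/a"] pos[of ?B "1/b"]
        by (auto simp: epowr_top[unfolded infinity_ennreal_def] ennreal_mult_eq_top_iff)
      then show ?thesis by simp
    next
      case False
      then obtain A B where A: "?A = ennreal A" "0 < A" and B: "?B = ennreal B" "0 < B"
        using nz by (cases ?A; cases ?B) (auto simp: less_le)
      define X where "X = A powr (1 / a)"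
      define Y where "Y = B powr (1 / b)"
      have XY: "0 < X" "0 < Y" "X powr a = A" "Y powr b = B"
        using A B ab by (auto simp: X_def Y_def powr_powr)
      \<comment> \<open>Young's inequality, applied to the functions divided by their norms\<close>
      have Y: "u x * v x \<le> X * Y * (u x powr a / (a * A) + v x powr b / (b * B))" for x
      proof -
        have "(u x / X) * (v x / Y) \<le> (u x / X) powr a / a + (v x / Y) powr b / b"
          by (rule Youngs_inequality) (use ab XY nonneg in auto)
        also have "\<dots> = u x powr a / (a * A) + v x powr b / (b * B)"
          using XY nonneg by (simp add: powr_divide field_simps)
        finally show ?thesis using XY by (simp add: field_simps)
      qed
      have "(\<integral>\<^sup>+x. ennreal (u x * v x) \<partial>M)
         \<le> (\<integral>\<^sup>+x. ennreal (X * Y / (a * A)) * ennreal (u x powr a)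
                 + ennreal (X * Y / (b * B)) * ennreal (v x powr b) \<partial>M)"
        using Y XY A B ab
        by (intro nn_integral_mono) (simp add: ennreal_leI distrib_left mult.assoc flip: ennreal_mult ennreal_plus)
      also have "\<dots> = ennreal (X * Y / (a * A)) * ennreal A + ennreal (X * Y / (b * B)) * ennreal B"
        by (subst nn_integral_add) (auto simp: nn_integral_cmult A B)
      also have "\<dots> = ennreal (X * Y * (1 / a + 1 / b))"
        using XY A B ab by (simp add: field_simps flip: ennreal_mult ennreal_plus)
      also have "\<dots> = epowr ?A (1 / a) * epowr ?B (1 / b)"
        using A B ab unfolding ab(3) by (simp add: epowr_ennreal X_def Y_def flip: ennreal_mult)
      finally show ?thesis .
    qed
  qed
qed

lemma Hoelder_set_nn_integral:
  fixes u v :: "'a \<Rightarrow> real"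
  assumes "u \<in> borel_measurable M" "v \<in> borel_measurable M" and S: "S \<in> sets M"
    and nonneg: "\<And>x. 0 \<le> u x" "\<And>x. 0 \<le> v x"
    and ab: "1 < a" "1 < b" "1 / a + 1 / b = 1"
  shows "(\<integral>\<^sup>+x\<in>S. ennreal (u x * v x) \<partial>M)
     \<le> epowr (\<integral>\<^sup>+x\<in>S. ennreal (u x powr a) \<partial>M) (1 / a) * epowr (\<integral>\<^sup>+x\<in>S. ennreal (v x powr b) \<partial>M) (1 / b)"
proof -
  have *: "(\<integral>\<^sup>+x\<in>S. h x \<partial>M) = (\<integral>\<^sup>+x. h x \<partial>restrict_space M S)" for h
    using S by (simp add: nn_integral_restrict_space)
  show ?thesis
    unfolding * using assms by (intro Hoelder_nn_integral) (auto intro: measurable_restrict_space1)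
qed

section \<open>Cubes and their dyadic subcubes\<close>

lemma mem_cube: "z \<in> cube x r \<longleftrightarrow> (\<forall>i. \<bar>z $ i - x $ i\<bar> \<le> r / 2)"
proof -
  have "x $ i - r / 2 \<le> z $ i \<and> z $ i \<le> x $ i + r / 2 \<longleftrightarrow> \<bar>z $ i - x $ i\<bar> \<le> r / 2" for i
    by linarith
  then show ?thesis
    by (simp add: cube_def mem_box_cart)
qed

lemma compact_cube [simp]: "compact (cube x r)"
  by (simp add: cube_def)

lemma sets_cube [simp, measurable]: "cube x r \<in> sets lebesgue"
  by (simp add: cube_def)

lemma measure_cube:
  fixes x :: "real ^ 'n"
  assumes "0 \<le> r" shows "measure lebesgue (cube x r) = r ^ CARD('n)"
proof -
  have "x \<in> cube x r" using assms by (simp add: mem_cube)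
  then show ?thesis
    unfolding cube_def by (subst measure_completion, simp, subst content_cbox_cart) auto
qed

lemma lmeasurable_cube [simp]: "cube x r \<in> lmeasurable"
  by (simp add: cube_def)

lemma emeasure_cube:
  fixes x :: "real ^ 'n"
  assumes "0 \<le> r" shows "emeasure lebesgue (cube x r) = ennreal (r ^ CARD('n))"
  using emeasure_eq_measure2[OF lmeasurable_cube, of x r] measure_cube[OF assms, of x] by simp

definition subcube_centre :: "real ^ 'n \<Rightarrow> real \<Rightarrow> 'n set \<Rightarrow> real ^ 'n" where
  "subcube_centre x s \<sigma> = x + (\<chi> i. if i \<in> \<sigma> then s / 4 else - (s / 4))"

lemma cube_eq_UN_subcubes: "cube x s = (\<Union>\<sigma>. cube (subcube_centre x s \<sigma>) (s / 2))"
proof (intro set_eqI iffI)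
  fix z assume z: "z \<in> cube x s"
  have "\<bar>z $ i - subcube_centre x s {i. x $ i \<le> z $ i} $ i\<bar> \<le> s / 2 / 2" for i
    using z[unfolded mem_cube, rule_format, of i] by (auto simp: subcube_centre_def abs_if split: if_splits)
  then show "z \<in> (\<Union>\<sigma>. cube (subcube_centre x s \<sigma>) (s / 2))"
    by (auto simp: mem_cube)
next
  fix z assume "z \<in> (\<Union>\<sigma>. cube (subcube_centre x s \<sigma>) (s / 2))"
  then obtain \<sigma> where \<sigma>: "z \<in> cube (subcube_centre x s \<sigma>) (s / 2)" by auto
  have "\<bar>z $ i - x $ i\<bar> \<le> s / 2" for i
    using \<sigma>[unfolded mem_cube, rule_format, of i] by (auto simp: subcube_centre_def abs_if split: if_splits)
  then show "z \<in> cube x s" by (simp add: mem_cube)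
qed

lemma subcube_subset: "cube (subcube_centre x s \<sigma>) (s / 2) \<subseteq> cube x s"
  using cube_eq_UN_subcubes[of x s] by auto

lemma measure_subcube:
  fixes x :: "real ^ 'n"
  assumes "0 \<le> s"
  shows "measure lebesgue (cube x s) = 2 ^ CARD('n) * measure lebesgue (cube (subcube_centre x s \<sigma>) (s / 2))"
  using assms by (simp add: measure_cube power_divide)

text \<open>Off the finitely many hyperplanes through the centre every point lies in exactly one of the
  subcubes.\<close>

lemma AE_indicator_subcubes:
  "AE z in lebesgue. indicator (cube x s) z = (\<Sum>\<sigma>\<in>UNIV. indicator (cube (subcube_centre x s \<sigma>) (s / 2)) z :: real)"
proof -
  have "negligible (\<Union>i. {z :: real ^ 'a. z $ i = x $ i})"
    by (intro negligible_Union) (auto simp: cart_eq_inner_axis intro!: negligible_standard_hyperplane)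
  then have "AE z in lebesgue. z \<notin> (\<Union>i. {z. z $ i = x $ i})"
    by (intro AE_not_in) (simp add: negligible_iff_null_sets)
  then show ?thesis
  proof eventually_elim
    case (elim z)
    define \<tau> where "\<tau> = {i. x $ i \<le> z $ i}"
    have "\<sigma> = \<tau>" if \<sigma>: "z \<in> cube (subcube_centre x s \<sigma>) (s / 2)" for \<sigma>
    proof -
      have "i \<in> \<sigma> \<longleftrightarrow> x $ i \<le> z $ i" for i
      proof -
        have "z $ i \<noteq> x $ i" using elim by auto
        then show ?thesis
          using \<sigma>[unfolded mem_cube, rule_format, of i]
          by (auto simp: subcube_centre_def abs_if split: if_splits)
      qed
      then show ?thesis by (auto simp: \<tau>_def)
    qed
    then have "(indicator (cube (subcube_centre x s \<sigma>) (s / 2)) z :: real) = (if \<sigma> = \<tau> then indicator (cube x s) z else 0)" for \<sigma>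
      using cube_eq_UN_subcubes[of x s] by (auto simp: indicator_def)
    then show ?case by simp
  qed
qed

lemma set_integral_subcubes:
  fixes h :: "real ^ 'n \<Rightarrow> real"
  assumes "set_integrable lebesgue (cube x s) h"
  shows "(LINT z:cube x s|lebesgue. h z) = (\<Sum>\<sigma>\<in>UNIV. LINT z:cube (subcube_centre x s \<sigma>) (s / 2)|lebesgue. h z)"
proof -
  have int: "integrable lebesgue (\<lambda>z. indicator (cube (subcube_centre x s \<sigma>) (s / 2)) z *\<^sub>R h z)" for \<sigma>
    using set_integrable_subset[OF assms _ subcube_subset] by (simp add: set_integrable_def)
  have "AE z in lebesgue. indicator (cube x s) z *\<^sub>R h z
      = (\<Sum>\<sigma>\<in>UNIV. indicator (cube (subcube_centre x s \<sigma>) (s / 2)) z *\<^sub>R h z)"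
    using AE_indicator_subcubes[of x s]
    by eventually_elim (simp only: scaleR_sum_left)
  then have "(LINT z:cube x s|lebesgue. h z)
      = (\<integral>z. (\<Sum>\<sigma>\<in>UNIV. indicator (cube (subcube_centre x s \<sigma>) (s / 2)) z *\<^sub>R h z) \<partial>lebesgue)"
    unfolding set_lebesgue_integral_def using int assms
    by (intro integral_cong_AE borel_measurable_integrable Bochner_Integration.integrable_sum) 
       (auto simp: set_integrable_def)
  also have "\<dots> = (\<Sum>\<sigma>\<in>UNIV. LINT z:cube (subcube_centre x s \<sigma>) (s / 2)|lebesgue. h z)"
    unfolding set_lebesgue_integral_def using int by (intro Bochner_Integration.integral_sum) 
  finally show ?thesis .
qed

section \<open>Set integrals and approximation by continuous functions\<close>

lemma set_Markov_inequality:
  fixes h :: "'a \<Rightarrow> real"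
  assumes int: "set_integrable M S h" and S: "S \<in> sets M" and h: "\<And>x. 0 \<le> h x" and "0 < c"
  shows "measure M {x \<in> S. c \<le> h x} \<le> (LINT x:S|M. h x) / c"
proof -
  have "{x \<in> space M. c \<le> indicator S x *\<^sub>R h x} = {x \<in> S. c \<le> h x}"
    using sets.sets_into_space[OF S] \<open>0 < c\<close> by (auto simp: indicator_def split: if_splits)
  then show ?thesis
    using integral_Markov_inequality_measure[of M "\<lambda>x. indicator S x *\<^sub>R h x" S c] assms
    by (simp add: set_integrable_def set_lebesgue_integral_def)
qed

text \<open>Measurability provides continuous functions that converge almost everywhere. Truncating both the
  function and its approximants at a large height makes dominated convergence applicable.\<close>

lemma L1_approx_continuous:
  fixes f :: "'a::euclidean_space \<Rightarrow> real"
  assumes f: "set_integrable lebesgue S f" and S: "S \<in> lmeasurable" and e: "0 < e"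
  obtains g where "continuous_on UNIV g" "set_integrable lebesgue S g"
    "(LINT x:S|lebesgue. \<bar>f x - g x\<bar>) < e"
proof -
  define F where "F x = indicator S x * f x" for x
  define clamp where "clamp k t = max (- real k) (min (real k) t)" for k t
  have F: "integrable lebesgue F"
    using f by (simp add: F_def[abs_def] set_integrable_def)
  then have Fm [measurable]: "F \<in> borel_measurable lebesgue" by auto
  have [measurable]: "S \<in> sets lebesgue" using S by auto
  have clamp_meas [measurable]: "clamp k \<in> borel_measurable borel" for k
    unfolding clamp_def by measurable
  have clamp_int: "set_integrable lebesgue S (\<lambda>x. clamp k (h x))"
    if "h \<in> borel_measurable lebesgue" for k and h :: "'a \<Rightarrow> real"
    unfolding set_integrable_def
  proof (rule Bochner_Integration.integrable_bound)
    show "integrable lebesgue (\<lambda>x. real k * indicator S x)"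
      using S by (auto simp: fmeasurable_def)
    show "(\<lambda>x. indicator S x *\<^sub>R clamp k (h x)) \<in> borel_measurable lebesgue"
      using that by measurable
  qed (auto simp: clamp_def indicator_def)
  have "(\<lambda>k. LINT x|lebesgue. \<bar>F x - clamp k (F x)\<bar>) \<longlonglongrightarrow> (LINT x|(lebesgue :: 'a measure). 0)"
  proof (rule integral_dominated_convergence)
    show "integrable lebesgue (\<lambda>x. \<bar>F x\<bar>)" using F by auto
    show "AE x in lebesgue. (\<lambda>k. \<bar>F x - clamp k (F x)\<bar>) \<longlonglongrightarrow> 0"
    proof (intro AE_I2 tendsto_eventually)
      fix x
      obtain K where "\<bar>F x\<bar> \<le> real K" using real_arch_simple by blast
      then have "\<forall>k\<ge>K. \<bar>F x - clamp k (F x)\<bar> = 0"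
        by (auto simp: clamp_def)
      then show "\<forall>\<^sub>F k in sequentially. \<bar>F x - clamp k (F x)\<bar> = 0"
        by (auto simp: eventually_sequentially)
    qed
  qed (auto simp: clamp_def)
  then have "\<forall>\<^sub>F k in sequentially. (LINT x|lebesgue. \<bar>F x - clamp k (F x)\<bar>) < e / 2"
    by (rule order_tendstoD) (use e in simp)
  then obtain k where k: "(LINT x|lebesgue. \<bar>F x - clamp k (F x)\<bar>) < e / 2"
    by (auto simp: eventually_sequentially)
  obtain N G where N: "negligible N" and G: "\<And>n. continuous_on UNIV (G n)"
    and lim: "\<And>x. x \<notin> N \<Longrightarrow> (\<lambda>n. G n x) \<longlonglongrightarrow> F x"
    using lebesgue_measurable_imp_measurable_on_real[OF Fm, of UNIV] by (auto simp: measurable_on_def)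
  define g where "g n x = clamp k (G n x)" for n x
  have g_cont: "continuous_on UNIV (g n)" for n
    unfolding g_def clamp_def by (intro continuous_intros G)
  have Gm [measurable]: "G n \<in> borel_measurable lebesgue" for n
    using borel_measurable_continuous_onI[OF G] by (simp add: measurable_completion)
  have "(\<lambda>n. LINT x:S|lebesgue. \<bar>clamp k (F x) - g n x\<bar>) \<longlonglongrightarrow> (LINT x:S|(lebesgue :: 'a measure). 0)"
    unfolding set_lebesgue_integral_def
  proof (rule integral_dominated_convergence)
    show "integrable lebesgue (\<lambda>x. 2 * real k * indicator S x)"
      using S by (auto simp: fmeasurable_def)
    have "AE x in lebesgue. x \<notin> N"
      by (intro AE_not_in) (use N negligible_iff_null_sets in auto)
    then show "AE x in lebesgue. (\<lambda>n. indicator S x *\<^sub>R \<bar>clamp k (F x) - g n x\<bar>) \<longlonglongrightarrow> indicator S x *\<^sub>R 0"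
    proof eventually_elim
      case (elim x)
      have "(\<lambda>n. indicator S x *\<^sub>R \<bar>clamp k (F x) - g n x\<bar>) \<longlonglongrightarrow> indicator S x *\<^sub>R \<bar>clamp k (F x) - clamp k (F x)\<bar>"
        unfolding g_def clamp_def by (intro tendsto_intros lim elim)
      then show ?case by simp
    qed
    show "AE x in lebesgue. norm (indicator S x *\<^sub>R \<bar>clamp k (F x) - g n x\<bar>) \<le> 2 * real k * indicator S x" for n
      by (intro AE_I2) (auto simp: g_def clamp_def indicator_def)
    show "(\<lambda>x. indicator S x *\<^sub>R \<bar>clamp k (F x) - g n x\<bar>) \<in> borel_measurable lebesgue" for n
      unfolding g_def by measurable
  qed auto
  then have "\<forall>\<^sub>F n in sequentially. (LINT x:S|lebesgue. \<bar>clamp k (F x) - g n x\<bar>) < e / 2"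
    by (rule order_tendstoD) (use e in simp)
  then obtain n where n: "(LINT x:S|lebesgue. \<bar>clamp k (F x) - g n x\<bar>) < e / 2"
    by (auto simp: eventually_sequentially)
  have gi: "set_integrable lebesgue S (g n)"
    unfolding g_def by (rule clamp_int) measurable
  have Fi: "set_integrable lebesgue S F"
    using f unfolding F_def set_integrable_def by (rule Bochner_Integration.integrable_cong[THEN iffD1, rotated 2]) (auto simp: indicator_def)
  have ci: "set_integrable lebesgue S (\<lambda>x. clamp k (F x))"
    by (rule clamp_int) measurable
  have "(LINT x:S|lebesgue. \<bar>f x - g n x\<bar>) \<le> (LINT x:S|lebesgue. \<bar>F x - clamp k (F x)\<bar> + \<bar>clamp k (F x) - g n x\<bar>)"
    using f gi Fi ci
    by (intro set_integral_mono set_integral_add set_integral_diff set_integrable_abs)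
       (assumption | simp add: F_def)+
  also have "\<dots> = (LINT x:S|lebesgue. \<bar>F x - clamp k (F x)\<bar>) + (LINT x:S|lebesgue. \<bar>clamp k (F x) - g n x\<bar>)"
    using f gi Fi ci by (intro set_integral_add set_integrable_abs set_integral_diff)
  also have "(LINT x:S|lebesgue. \<bar>F x - clamp k (F x)\<bar>) = (LINT x|lebesgue. \<bar>F x - clamp k (F x)\<bar>)"
    unfolding set_lebesgue_integral_def by (intro Bochner_Integration.integral_cong) (auto simp: F_def clamp_def indicator_def)
  finally have "(LINT x:S|lebesgue. \<bar>f x - g n x\<bar>) < e"
    using k n by linarith
  with that g_cont gi show ?thesis by blast
qed

lemma locally_integrable_on_compact:
  "locally_integrable f \<Longrightarrow> compact K \<Longrightarrow> set_integrable lebesgue K f"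
  by (simp add: locally_integrable_def)

lemma locally_integrable_measurable:
  fixes f :: "real ^ 'n \<Rightarrow> real"
  assumes "locally_integrable f" shows "f \<in> borel_measurable lebesgue"
proof (rule borel_measurable_LIMSEQ_real)
  fix k :: nat
  show "(\<lambda>x. indicator (cball 0 (real k)) x *\<^sub>R f x) \<in> borel_measurable lebesgue"
    using locally_integrable_on_compact[OF assms, of "cball 0 (real k)"]
    by (auto simp: set_integrable_def)
next
  fix x :: "real ^ 'n"
  obtain K where K: "norm x \<le> real K" using real_arch_simple by blast
  have "\<forall>\<^sub>F k in sequentially. indicator (cball 0 (real k)) x *\<^sub>R f x = f x"
    using eventually_ge_at_top[of K] by eventually_elim (use K in auto)
  then show "(\<lambda>k. indicator (cball 0 (real k)) x *\<^sub>R f x) \<longlonglongrightarrow> f x"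
    by (rule tendsto_eventually)
qed

lemma nn_integral_eq_set_integral:
  fixes h :: "'a \<Rightarrow> real"
  assumes "set_integrable M S h" "\<And>x. 0 \<le> h x"
  shows "(\<integral>\<^sup>+x\<in>S. ennreal (h x) \<partial>M) = ennreal (LINT x:S|M. h x)"
proof -
  have "(\<integral>\<^sup>+x\<in>S. ennreal (h x) \<partial>M) = (\<integral>\<^sup>+x. ennreal (indicator S x *\<^sub>R h x) \<partial>M)"
    by (intro nn_integral_cong) (auto simp: indicator_def)
  then show ?thesis
    using assms by (simp add: nn_integral_eq_integral set_integrable_def set_lebesgue_integral_def)
qed

section \<open>Mean oscillation\<close>

lemma lmeasurable_superlevel:
  fixes f :: "'a::euclidean_space \<Rightarrow> real"
  assumes f: "set_integrable lebesgue S f" and S: "S \<in> lmeasurable"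
  shows "{z \<in> S. c < \<bar>f z - a\<bar>} \<in> lmeasurable"
proof -
  have [measurable]: "(\<lambda>z. indicator S z *\<^sub>R f z) \<in> borel_measurable lebesgue"
    using f by (auto simp: set_integrable_def)
  have [measurable]: "S \<in> sets lebesgue" using S by auto
  have "{z \<in> space lebesgue. z \<in> S \<and> c < \<bar>indicator S z *\<^sub>R f z - a\<bar>} \<in> sets lebesgue"
    by measurable
  also have "{z \<in> space lebesgue. z \<in> S \<and> c < \<bar>indicator S z *\<^sub>R f z - a\<bar>} = {z \<in> S. c < \<bar>f z - a\<bar>}"
    by auto
  finally show ?thesis
    using S by (rule fmeasurableI2[rotated 2]) auto
qed

lemma set_integrable_abs_diff_const:
  fixes f :: "'a::euclidean_space \<Rightarrow> real"
  assumes "set_integrable lebesgue S f" "S \<in> lmeasurable"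
  shows "set_integrable lebesgue S (\<lambda>z. \<bar>f z - a\<bar>)"
proof -
  have "set_integrable lebesgue S (\<lambda>z. a)"
    using assms(2) by (auto simp: set_integrable_def fmeasurable_def)
  then show ?thesis
    using assms by (intro set_integrable_abs set_integral_diff)
qed

text \<open>The difference of the mean and \<open>a\<close> is the mean of \<open>f - a\<close>. The product form makes the inequality
  meaningful on null sets as well.\<close>

lemma mean_diff_le:
  fixes f :: "real ^ 'n \<Rightarrow> real"
  assumes f: "set_integrable lebesgue S f" and S: "S \<in> lmeasurable"
  shows "\<bar>mean S f - a\<bar> * measure lebesgue S \<le> (LINT z:S|lebesgue. \<bar>f z - a\<bar>)"
proof (cases "measure lebesgue S = 0")
  case True
  then show ?thesis by (simp add: set_lebesgue_integral_def)
next
  case False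
  have a: "set_integrable lebesgue S (\<lambda>z. a)" "(LINT z:S|lebesgue. a) = a * measure lebesgue S"
    using S by (auto simp: set_integrable_def set_lebesgue_integral_def fmeasurable_def)
  have "\<bar>mean S f - a\<bar> * measure lebesgue S = \<bar>(mean S f - a) * measure lebesgue S\<bar>"
    by (simp add: abs_mult)
  also have "(mean S f - a) * measure lebesgue S = (LINT z:S|lebesgue. f z - a)"
    using False f a by (simp add: mean_def left_diff_distrib)
  also have "\<bar>\<dots>\<bar> \<le> (LINT z:S|lebesgue. \<bar>f z - a\<bar>)"
    using set_integral_norm_bound[OF set_integral_diff(1)[OF f a(1)]] by simp
  finally show ?thesis .
qed

text \<open>The triangle inequality, since the mean lies within the average of \<open>\<bar>f - a\<bar>\<close> of \<open>a\<close>.\<close>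

lemma oscillation_le_twice:
  fixes f :: "real ^ 'n \<Rightarrow> real"
  assumes f: "set_integrable lebesgue S f" and S: "S \<in> lmeasurable"
  shows "(LINT z:S|lebesgue. \<bar>f z - mean S f\<bar>) \<le> 2 * (LINT z:S|lebesgue. \<bar>f z - a\<bar>)"
proof -
  note int = set_integrable_abs_diff_const[OF f S]
  have c: "set_integrable lebesgue S (\<lambda>_. c)" "(LINT z:S|lebesgue. c) = c * measure lebesgue S" for c :: real
    using S by (auto simp: set_integrable_def set_lebesgue_integral_def fmeasurable_def)
  have "(LINT z:S|lebesgue. \<bar>f z - mean S f\<bar>) \<le> (LINT z:S|lebesgue. \<bar>f z - a\<bar> + \<bar>mean S f - a\<bar>)"
    by (intro set_integral_mono set_integral_add int c) auto
  also have "\<dots> = (LINT z:S|lebesgue. \<bar>f z - a\<bar>) + \<bar>mean S f - a\<bar> * measure lebesgue S"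
    using set_integral_add(2)[OF int c(1)] c(2) by simp
  finally show ?thesis using mean_diff_le[OF f S, of a] by linarith
qed

section \<open>The John--Nirenberg inequality\<close>

text \<open>The stopping argument, arranged as an induction on the number \<open>m\<close> of bisections after which the
  subcubes are so small that \<open>g\<close> varies by at most \<open>\<epsilon>\<close> on them. The number \<open>a\<close> stands for the mean over
  the initial cube and stays fixed while \<open>cube x s\<close> runs through the cubes at which the process has not
  stopped, those with \<open>\<bar>mean (cube x s) f - a\<bar> \<le> T\<close>. A subcube at which it stops has a mean that
  differs from \<open>a\<close> by more than \<open>T\<close>, which pays for its whole volume with \<open>1 / T\<close> times the integral of
  \<open>\<bar>f - a\<bar>\<close>; as a mean changes by at most \<open>D\<close> in one bisection, exceeding \<open>t + T + D\<close> relative to \<open>a\<close>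
  implies exceeding \<open>t\<close> relative to the mean of that subcube. The cubes that never stop contribute only the
  error term with \<open>g\<close>. Both terms of the bound are integrals over the cube, hence additive under
  bisection, so the bounds for the subcubes add up to the bound for the cube.\<close>

lemma John_Nirenberg_stopping:
  fixes f g :: "real ^ 'n \<Rightarrow> real" and s \<delta> :: real
  assumes f: "set_integrable lebesgue Q f" and g: "set_integrable lebesgue Q g"
    and unif: "\<And>y z. y \<in> Q \<Longrightarrow> z \<in> Q \<Longrightarrow> dist y z < \<delta> \<Longrightarrow> \<bar>g y - g z\<bar> \<le> \<epsilon>"
    and bmo: "\<And>x s. 0 < s \<Longrightarrow> cube x s \<subseteq> Q \<Longrightarrow>
      (LINT z:cube x s|lebesgue. \<bar>f z - mean (cube x s) f\<bar>) \<le> M * measure lebesgue (cube x s)"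
    and \<beta>: "\<And>x s. 0 < s \<Longrightarrow> cube x s \<subseteq> Q \<Longrightarrow>
      measure lebesgue {z \<in> cube x s. t < \<bar>f z - mean (cube x s) f\<bar>} \<le> \<beta> * measure lebesgue (cube x s)"
    and pos: "0 \<le> t" "0 < T" "0 \<le> \<beta>" "0 < M" and D: "D = 2 ^ CARD('n) * M"
  shows "0 < s \<Longrightarrow> cube x s \<subseteq> Q \<Longrightarrow> CARD('n) * s < \<delta> * 2 ^ m \<Longrightarrow> \<bar>mean (cube x s) f - a\<bar> \<le> T \<Longrightarrow>
    measure lebesgue {z \<in> cube x s. t + T + D < \<bar>f z - a\<bar>}
    \<le> \<beta> / T * (LINT z:cube x s|lebesgue. \<bar>f z - a\<bar>)
      + 2 / D * ((LINT z:cube x s|lebesgue. \<bar>f z - g z\<bar>) + \<epsilon> * measure lebesgue (cube x s))"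
proof (induction m arbitrary: x s)
  case 0
  let ?v = "cube x s"
  have Dpos: "0 < D" using D pos by simp
  note v = lmeasurable_cube[of x s]
  have fv: "set_integrable lebesgue ?v f" and gv: "set_integrable lebesgue ?v g"
    using set_integrable_subset[OF f _ 0(2)] set_integrable_subset[OF g _ 0(2)] by auto
  have xv: "x \<in> ?v" using 0 by (simp add: mem_cube)
  have fg: "set_integrable lebesgue ?v (\<lambda>z. \<bar>f z - g z\<bar>)"
    using fv gv by (intro set_integrable_abs set_integral_diff)
  have e: "set_integrable lebesgue ?v (\<lambda>_. \<epsilon>)" "(LINT z:?v|lebesgue. \<epsilon>) = \<epsilon> * measure lebesgue ?v"
    using v by (auto simp: set_integrable_def set_lebesgue_integral_def fmeasurable_def)
  have near: "\<bar>g z - g x\<bar> \<le> \<epsilon>" if "z \<in> ?v" for z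
  proof (rule unif)
    have "norm (z - x) \<le> (\<Sum>i\<in>UNIV. \<bar>(z - x) $ i\<bar>)" by (rule norm_le_l1_cart)
    also have "\<dots> \<le> (\<Sum>i\<in>(UNIV :: 'n set). s / 2)"
      using that by (intro sum_mono) (simp add: mem_cube)
    also have "\<dots> < \<delta>"
    proof -
      have "0 < real CARD('n) * s" using 0 by simp
      moreover have "real CARD('n) * s < \<delta>" using 0 by simp
      ultimately have "real CARD('n) * s < \<delta> * 2" by linarith
      then show ?thesis by simp
    qed
    finally show "dist z x < \<delta>" by (simp add: dist_norm)
  qed (use 0 that xv in auto)
  have "measure lebesgue {z \<in> ?v. t + T + D < \<bar>f z - a\<bar>} \<le> measure lebesgue {z \<in> ?v. D \<le> \<bar>f z - mean ?v f\<bar>}"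
  proof (rule measure_mono_fmeasurable)
    show "{z \<in> ?v. t + T + D < \<bar>f z - a\<bar>} \<subseteq> {z \<in> ?v. D \<le> \<bar>f z - mean ?v f\<bar>}"
      using 0 pos by auto
    have *: "{z \<in> ?v. D \<le> \<bar>f z - mean ?v f\<bar>} = ?v - {z \<in> ?v. \<bar>f z - mean ?v f\<bar> < D}" by auto
    have [measurable]: "(\<lambda>z. indicator ?v z *\<^sub>R f z) \<in> borel_measurable lebesgue"
      using fv by (auto simp: set_integrable_def)
    have "{z \<in> space lebesgue. z \<in> ?v \<and> D \<le> \<bar>indicator ?v z *\<^sub>R f z - mean ?v f\<bar>} \<in> sets lebesgue"
      by measurable
    also have "{z \<in> space lebesgue. z \<in> ?v \<and> D \<le> \<bar>indicator ?v z *\<^sub>R f z - mean ?v f\<bar>} = {z \<in> ?v. D \<le> \<bar>f z - mean ?v f\<bar>}"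
      by auto
    finally show "{z \<in> ?v. D \<le> \<bar>f z - mean ?v f\<bar>} \<in> lmeasurable"
      using v by (rule fmeasurableI2[rotated 2]) auto
  qed (use lmeasurable_superlevel[OF fv v] in auto)
  also have "\<dots> \<le> (LINT z:?v|lebesgue. \<bar>f z - mean ?v f\<bar>) / D"
    using Dpos fv by (intro set_Markov_inequality set_integrable_abs_diff_const) auto
  also have "\<dots> \<le> 2 * (LINT z:?v|lebesgue. \<bar>f z - g x\<bar>) / D"
    using oscillation_le_twice[OF fv v] Dpos by (intro divide_right_mono) auto
  also have "\<dots> \<le> 2 * ((LINT z:?v|lebesgue. \<bar>f z - g z\<bar>) + \<epsilon> * measure lebesgue ?v) / D"
  proof -
    have "(LINT z:?v|lebesgue. \<bar>f z - g x\<bar>) \<le> (LINT z:?v|lebesgue. \<bar>f z - g z\<bar> + \<epsilon>)"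
      using near by (intro set_integral_mono set_integral_add fg e set_integrable_abs_diff_const fv v) fastforce
    also have "\<dots> = (LINT z:?v|lebesgue. \<bar>f z - g z\<bar>) + \<epsilon> * measure lebesgue ?v"
      using set_integral_add(2)[OF fg e(1)] e(2) by simp
    finally show ?thesis using Dpos by (intro divide_right_mono mult_left_mono) auto
  qed
  finally have *: "measure lebesgue {z \<in> ?v. t + T + D < \<bar>f z - a\<bar>}
     \<le> 2 / D * ((LINT z:?v|lebesgue. \<bar>f z - g z\<bar>) + \<epsilon> * measure lebesgue ?v)" by simp
  have "0 \<le> \<beta> / T * (LINT z:?v|lebesgue. \<bar>f z - a\<bar>)"
    using pos by (simp add: set_lebesgue_integral_def)
  with * show ?case by linarith
next
  case (Suc m)
  let ?v = "cube x s" and ?c = "\<lambda>\<sigma>. cube (subcube_centre x s \<sigma>) (s / 2)"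
  define E where "E S = \<beta> / T * (LINT z:S|lebesgue. \<bar>f z - a\<bar>)
      + 2 / D * ((LINT z:S|lebesgue. \<bar>f z - g z\<bar>) + \<epsilon> * measure lebesgue S)" for S
  have Dpos: "0 < D" using D pos by simp
  note v = lmeasurable_cube[of x s]
  have fv: "set_integrable lebesgue ?v f" and gv: "set_integrable lebesgue ?v g"
    using set_integrable_subset[OF f _ Suc.prems(2)] set_integrable_subset[OF g _ Suc.prems(2)] by auto
  have fg: "set_integrable lebesgue ?v (\<lambda>z. \<bar>f z - g z\<bar>)"
    using fv gv by (intro set_integrable_abs set_integral_diff)
  have one: "set_integrable lebesgue ?v (\<lambda>_. 1 :: real)" 
    using v by (auto simp: set_integrable_def fmeasurable_def)
  have meas: "(LINT z:cube y r|lebesgue. 1 :: real) = measure lebesgue (cube y r)" for y :: "real ^ 'n" and r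
    by (auto simp: set_lebesgue_integral_def)
  have child: "measure lebesgue {z \<in> ?c \<sigma>. t + T + D < \<bar>f z - a\<bar>} \<le> E (?c \<sigma>)" for \<sigma>
  proof -
    have cQ: "?c \<sigma> \<subseteq> Q" and s2: "0 < s / 2" using subcube_subset[of x s \<sigma>] Suc.prems by auto
    have fc: "set_integrable lebesgue (?c \<sigma>) f"
      using set_integrable_subset[OF f _ cQ] by auto
    show ?thesis
    proof (cases "\<bar>mean (?c \<sigma>) f - a\<bar> \<le> T")
      case True
      show ?thesis unfolding E_def
        using Suc.prems by (intro Suc.IH s2 cQ True) (simp add: field_simps)
    next
      case False
      define N where "N = measure lebesgue (?c \<sigma>)"
      have N: "0 < N" using s2 by (simp add: N_def measure_cube)
      have "\<bar>mean (?c \<sigma>) f - mean ?v f\<bar> * N \<le> (LINT z:?c \<sigma>|lebesgue. \<bar>f z - mean ?v f\<bar>)"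
        unfolding N_def by (rule mean_diff_le[OF fc]) simp
      also have "\<dots> \<le> (LINT z:?v|lebesgue. \<bar>f z - mean ?v f\<bar>)"
      proof -
        have i: "set_integrable lebesgue ?v (\<lambda>z. \<bar>f z - mean ?v f\<bar>)"
          by (rule set_integrable_abs_diff_const[OF fv v])
        have i': "set_integrable lebesgue (?c \<sigma>) (\<lambda>z. \<bar>f z - mean ?v f\<bar>)"
          using set_integrable_subset[OF i _ subcube_subset] by simp
        show ?thesis
          using i i' subcube_subset[of x s \<sigma>] unfolding set_lebesgue_integral_def set_integrable_def
          by (intro integral_mono) (auto simp: indicator_def)
      qed
      also have "\<dots> \<le> M * (2 ^ CARD('n) * N)"
        using bmo[OF Suc.prems(1,2)] measure_subcube[of s x \<sigma>] Suc.prems(1) by (simp add: N_def)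
      also have "\<dots> = D * N" by (simp add: D)
      finally have jump: "\<bar>mean (?c \<sigma>) f - mean ?v f\<bar> \<le> D" using N by simp
      have "measure lebesgue {z \<in> ?c \<sigma>. t + T + D < \<bar>f z - a\<bar>}
          \<le> measure lebesgue {z \<in> ?c \<sigma>. t < \<bar>f z - mean (?c \<sigma>) f\<bar>}"
      proof (rule measure_mono_fmeasurable)
        show "{z \<in> ?c \<sigma>. t + T + D < \<bar>f z - a\<bar>} \<subseteq> {z \<in> ?c \<sigma>. t < \<bar>f z - mean (?c \<sigma>) f\<bar>}"
          using jump Suc.prems(4) by auto
      qed (use lmeasurable_superlevel[OF fc lmeasurable_cube] fmeasurableD in blast)+
      also have "\<dots> \<le> \<beta> * N" using \<beta>[OF s2 cQ] by (simp add: N_def)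
      also have "\<dots> \<le> \<beta> / T * (\<bar>mean (?c \<sigma>) f - a\<bar> * N)"
      proof -
        have "T * N \<le> \<bar>mean (?c \<sigma>) f - a\<bar> * N" using False N by (intro mult_right_mono) auto
        then have "\<beta> / T * (T * N) \<le> \<beta> / T * (\<bar>mean (?c \<sigma>) f - a\<bar> * N)"
          using pos by (intro mult_left_mono) auto
        then show ?thesis using pos by simp
      qed
      also have "\<dots> \<le> \<beta> / T * (LINT z:?c \<sigma>|lebesgue. \<bar>f z - a\<bar>)"
        unfolding N_def using pos by (intro mult_left_mono mean_diff_le[OF fc]) auto
      also have "\<dots> \<le> E (?c \<sigma>)"
      proof -
        have "0 < real CARD('n) * s" using Suc.prems(1) by simp
        then have "0 < \<delta> * 2 ^ Suc m" using Suc.prems(3) by linarith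
        then have "0 < \<delta>" by (simp add: zero_less_mult_iff)
        then have "0 \<le> \<epsilon>" using unif[of "x" "x"] Suc.prems(1,2) by (force simp: mem_cube)
        then show ?thesis
          using Dpos by (simp add: E_def set_lebesgue_integral_def)
      qed
      finally show ?thesis .
    qed
  qed
  have "measure lebesgue {z \<in> ?v. t + T + D < \<bar>f z - a\<bar>}
      = measure lebesgue (\<Union>\<sigma>. {z \<in> ?c \<sigma>. t + T + D < \<bar>f z - a\<bar>})"
    using cube_eq_UN_subcubes[of x s] by (intro arg_cong[where f = "measure lebesgue"]) auto
  also have "measure lebesgue (\<Union>\<sigma>. {z \<in> ?c \<sigma>. t + T + D < \<bar>f z - a\<bar>})
      \<le> (\<Sum>\<sigma>\<in>UNIV. measure lebesgue {z \<in> ?c \<sigma>. t + T + D < \<bar>f z - a\<bar>})"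
  proof (rule measure_UNION_le)
    fix \<sigma>
    have "set_integrable lebesgue (?c \<sigma>) f"
      using set_integrable_subset[OF fv _ subcube_subset] by auto
    then show "{z \<in> ?c \<sigma>. t + T + D < \<bar>f z - a\<bar>} \<in> sets lebesgue"
      using lmeasurable_superlevel[of "?c \<sigma>" f] by auto
  qed simp
  also have "\<dots> \<le> (\<Sum>\<sigma>\<in>UNIV. E (?c \<sigma>))" by (intro sum_mono child)
  also have "(\<Sum>\<sigma>\<in>UNIV. E (?c \<sigma>)) = E ?v"
    unfolding E_def set_integral_subcubes[OF set_integrable_abs_diff_const[OF fv v]]
      set_integral_subcubes[OF fg] meas[symmetric] set_integral_subcubes[OF one]
    by (simp only: sum.distrib sum_distrib_left distrib_left)
  finally show ?case unfolding E_def .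
qed

text \<open>With \<open>T = 2 * M\<close> the first term of the stopping bound is at most \<open>\<beta> / 2\<close> times the volume, and the
  error term can be made as small as desired by the choice of \<open>g\<close> and \<open>m\<close>.\<close>

lemma John_Nirenberg_halving:
  fixes f :: "real ^ 'n \<Rightarrow> real" and s :: real
  assumes f: "set_integrable lebesgue Q f"
    and bmo: "\<And>x s. 0 < s \<Longrightarrow> cube x s \<subseteq> Q \<Longrightarrow>
      (LINT z:cube x s|lebesgue. \<bar>f z - mean (cube x s) f\<bar>) \<le> M * measure lebesgue (cube x s)"
    and \<beta>: "\<And>x s. 0 < s \<Longrightarrow> cube x s \<subseteq> Q \<Longrightarrow>
      measure lebesgue {z \<in> cube x s. t < \<bar>f z - mean (cube x s) f\<bar>} \<le> \<beta> * measure lebesgue (cube x s)"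
    and pos: "0 \<le> t" "0 \<le> \<beta>" "0 < M" and s: "0 < s" and vQ: "cube x s \<subseteq> Q"
  shows "measure lebesgue {z \<in> cube x s. t + (2 + 2 ^ CARD('n)) * M < \<bar>f z - mean (cube x s) f\<bar>}
    \<le> \<beta> / 2 * measure lebesgue (cube x s)"
proof (rule field_le_epsilon)
  fix e :: real assume e: "0 < e"
  let ?v = "cube x s"
  define N where "N = measure lebesgue ?v"
  define D where "D = 2 ^ CARD('n) * M"
  have N: "0 < N" using s by (simp add: N_def measure_cube)
  have D: "0 < D" using pos by (simp add: D_def)
  have fv: "set_integrable lebesgue ?v f"
    using set_integrable_subset[OF f _ vQ] by auto
  \<comment> \<open>The factor \<open>2 / D\<close> of the error term turns the two quarters of \<open>e * D\<close> into \<open>e\<close>.\<close>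
  obtain g where g: "continuous_on UNIV g" "set_integrable lebesgue ?v g"
    and fg: "(LINT z:?v|lebesgue. \<bar>f z - g z\<bar>) < e * D / 4"
    using L1_approx_continuous[OF fv, of "e * D / 4"] e D by auto
  define \<epsilon> where "\<epsilon> = e * D / (4 * N)"
  have \<epsilon>: "0 < \<epsilon>" using e D N by (simp add: \<epsilon>_def)
  have "uniformly_continuous_on ?v g"
    using g(1) by (intro compact_uniformly_continuous) (auto intro: continuous_on_subset)
  then obtain \<delta> where \<delta>: "0 < \<delta>" and unif: "\<And>y z. y \<in> ?v \<Longrightarrow> z \<in> ?v \<Longrightarrow> dist z y < \<delta> \<Longrightarrow> dist (g z) (g y) < \<epsilon>"
    using \<epsilon> by (rule uniformly_continuous_onE) auto
  obtain m where m: "CARD('n) * s / \<delta> < 2 ^ m"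
    using real_arch_pow[of 2 "CARD('n) * s / \<delta>"] by auto
  have "measure lebesgue {z \<in> ?v. t + 2 * M + D < \<bar>f z - mean ?v f\<bar>}
    \<le> \<beta> / (2 * M) * (LINT z:?v|lebesgue. \<bar>f z - mean ?v f\<bar>)
      + 2 / D * ((LINT z:?v|lebesgue. \<bar>f z - g z\<bar>) + \<epsilon> * measure lebesgue ?v)"
  proof (rule John_Nirenberg_stopping[where Q = ?v and M = M and m = m and \<delta> = \<delta>])
    show "real CARD('n) * s < \<delta> * 2 ^ m" using m \<delta> by (simp add: field_simps)
    show "\<bar>g y - g z\<bar> \<le> \<epsilon>" if "y \<in> ?v" "z \<in> ?v" "dist y z < \<delta>" for y z
      using unif[OF that(2,1,3)] by (simp add: dist_real_def)
    show "(LINT z:cube y r|lebesgue. \<bar>f z - mean (cube y r) f\<bar>) \<le> M * measure lebesgue (cube y r)"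
      if "0 < r" "cube y r \<subseteq> ?v" for y r
      using bmo[of r y] that vQ by blast
    show "measure lebesgue {z \<in> cube y r. t < \<bar>f z - mean (cube y r) f\<bar>} \<le> \<beta> * measure lebesgue (cube y r)"
      if "0 < r" "cube y r \<subseteq> ?v" for y r
      using \<beta>[of r y] that vQ by blast
    show "set_integrable lebesgue ?v f" "set_integrable lebesgue ?v g" by fact+
    show "D = 2 ^ CARD('n) * M" by (rule D_def)
  qed (use pos s in simp_all)
  also have "\<dots> \<le> \<beta> / (2 * M) * (M * N) + 2 / D * (e * D / 4 + \<epsilon> * N)"
    using bmo[OF s vQ] fg pos D \<epsilon> unfolding N_def by (intro add_mono mult_left_mono) simp_all
  also have "\<dots> = \<beta> / 2 * N + e"
    using N D pos by (simp add: \<epsilon>_def field_simps)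
  finally have "measure lebesgue {z \<in> ?v. t + 2 * M + D < \<bar>f z - mean ?v f\<bar>} \<le> \<beta> / 2 * N + e" .
  moreover have "t + (2 + 2 ^ CARD('n)) * M = t + 2 * M + D" by (simp add: D_def algebra_simps)
  ultimately show "measure lebesgue {z \<in> ?v. t + (2 + 2 ^ CARD('n)) * M < \<bar>f z - mean ?v f\<bar>}
    \<le> \<beta> / 2 * measure lebesgue ?v + e"
    by (simp only: N_def)
qed

lemma John_Nirenberg:
  fixes f :: "real ^ 'n \<Rightarrow> real" and s :: real
  assumes f: "set_integrable lebesgue Q f"
    and bmo: "\<And>x s. 0 < s \<Longrightarrow> cube x s \<subseteq> Q \<Longrightarrow>
      (LINT z:cube x s|lebesgue. \<bar>f z - mean (cube x s) f\<bar>) \<le> M * measure lebesgue (cube x s)"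
    and M: "0 < M"
  shows "0 < s \<Longrightarrow> cube x s \<subseteq> Q \<Longrightarrow>
    measure lebesgue {z \<in> cube x s. real k * ((2 + 2 ^ CARD('n)) * M) < \<bar>f z - mean (cube x s) f\<bar>}
    \<le> (1 / 2) ^ k * measure lebesgue (cube x s)"
proof (induction k arbitrary: x s)
  case 0
  have "set_integrable lebesgue (cube x s) f"
    using set_integrable_subset[OF f _ 0(2)] by auto
  then have "{z \<in> cube x s. 0 < \<bar>f z - mean (cube x s) f\<bar>} \<in> lmeasurable"
    by (rule lmeasurable_superlevel) simp
  then show ?case
    by simp (rule measure_mono_fmeasurable; auto)
next
  case (Suc k)
  have "measure lebesgue {z \<in> cube x s. real k * ((2 + 2 ^ CARD('n)) * M) + (2 + 2 ^ CARD('n)) * M < \<bar>f z - mean (cube x s) f\<bar>}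
    \<le> (1 / 2) ^ k / 2 * measure lebesgue (cube x s)"
  proof (rule John_Nirenberg_halving[OF f])
    show "(LINT z:cube y r|lebesgue. \<bar>f z - mean (cube y r) f\<bar>) \<le> M * measure lebesgue (cube y r)"
      if "0 < r" "cube y r \<subseteq> Q" for y r
      using that by (rule bmo)
    show "measure lebesgue {z \<in> cube y r. real k * ((2 + 2 ^ CARD('n)) * M) < \<bar>f z - mean (cube y r) f\<bar>}
        \<le> (1 / 2) ^ k * measure lebesgue (cube y r)"
      if "0 < r" "cube y r \<subseteq> Q" for y r
      using that by (rule Suc.IH)
    show "0 \<le> real k * ((2 + 2 ^ CARD('n)) * M)" using M by (intro mult_nonneg_nonneg add_nonneg_nonneg) auto
  qed (use M Suc.prems in simp_all)
  moreover have "real k * ((2 + 2 ^ CARD('n)) * M) + (2 + 2 ^ CARD('n)) * M = real (Suc k) * ((2 + 2 ^ CARD('n)) * M)"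
    by (simp add: algebra_simps)
  moreover have "(1 / 2) ^ k / 2 = (1 / 2 :: real) ^ Suc k" by simp
  ultimately show ?case by (simp only:)
qed

text \<open>The polynomial factor is at most a constant times \<open>(3 / 2) ^ k\<close>, by \<open>1 + c * k \<le> exp (c * k)\<close> for a
  sufficiently small \<open>c\<close>.\<close>

lemma summable_moments:
  assumes q: "0 < q"
  shows "summable (\<lambda>k. (real k + 1) powr q * (1 / 2) ^ k)"
proof -
  define c where "c = min 1 (ln (3 / 2) / q)"
  have c: "0 < c" "c \<le> 1" "c * q \<le> ln (3 / 2)"
    using q by (auto simp: c_def min_def field_simps)
  show ?thesis
  proof (rule summable_comparison_test')
    show "summable (\<lambda>k. (1 / c) powr q * (3 / 4) ^ k)"
      by (intro summable_mult summable_geometric) simp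
    fix k :: nat
    have "(real k + 1) * c \<le> exp (c * real k)"
    proof -
      have "(real k + 1) * c = c * real k + c" by (simp add: algebra_simps)
      then show ?thesis using exp_ge_add_one_self[of "c * real k"] c by linarith
    qed
    then have "(real k + 1) powr q \<le> (1 / c * exp (c * real k)) powr q"
      using c q by (intro powr_mono2) (auto simp: field_simps)
    also have "\<dots> = (1 / c) powr q * exp (c * q) ^ k"
      using c by (subst powr_mult) (simp_all add: exp_powr_real mult_ac flip: exp_of_nat_mult)
    also have "exp (c * q) ^ k \<le> (3 / 2) ^ k"
      using c(3) by (intro power_mono) (auto simp: ln_ge_iff)
    finally have "(real k + 1) powr q * (1 / 2) ^ k \<le> (1 / c) powr q * (3 / 2) ^ k * (1 / 2) ^ k"
      by (simp add: mult_left_mono mult_right_mono)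
    also have "\<dots> = (1 / c) powr q * (3 / 4) ^ k"
      by (simp add: mult.assoc flip: power_mult_distrib)
    finally show "norm ((real k + 1) powr q * (1 / 2) ^ k) \<le> (1 / c) powr q * (3 / 4) ^ k"
      by simp
  qed
qed

text \<open>The levels are \<open>K, 2 * K, \<dots>\<close> with \<open>K = (2 + 2 ^ n) * M\<close>: where the oscillation lies
  between the levels \<open>k * K\<close> and \<open>(k + 1) * K\<close>, its power is at most \<open>((k + 1) * K) powr q\<close>, and this happens
  on at most the fraction \<open>(1 / 2) ^ k\<close> of the cube.\<close>

lemma John_Nirenberg_moment:
  fixes f :: "real ^ 'n \<Rightarrow> real" and r q :: real
  assumes f: "set_integrable lebesgue (cube x r) f"
    and bmo: "\<And>y s. 0 < s \<Longrightarrow> cube y s \<subseteq> cube x r \<Longrightarrow>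
      (LINT z:cube y s|lebesgue. \<bar>f z - mean (cube y s) f\<bar>) \<le> M * measure lebesgue (cube y s)"
    and M: "0 < M" and r: "0 < r" and q: "0 < q"
  shows "(\<integral>\<^sup>+z\<in>cube x r. ennreal (\<bar>f z - mean (cube x r) f\<bar> powr q) \<partial>lebesgue)
    \<le> ennreal ((\<Sum>k. (real k + 1) powr q * (1 / 2) ^ k) * ((2 + 2 ^ CARD('n)) * M) powr q * measure lebesgue (cube x r))"
proof -
  let ?v = "cube x r" and ?h = "\<lambda>z. \<bar>f z - mean (cube x r) f\<bar>"
  define K where "K = (2 + 2 ^ CARD('n)) * M"
  define N where "N = measure lebesgue ?v"
  have K: "0 < K" using M by (simp add: K_def add_pos_pos)
  define L where "L k = {z \<in> ?v. real k * K < ?h z}" for k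
  have L: "L k \<in> lmeasurable" for k
    unfolding L_def by (rule lmeasurable_superlevel[OF f]) simp
  then have [measurable]: "L k \<in> sets lebesgue" for k by auto
  have "(\<integral>\<^sup>+z\<in>?v. ennreal (?h z powr q) \<partial>lebesgue)
     \<le> (\<integral>\<^sup>+z. (\<Sum>k. ennreal ((real k + 1) powr q * K powr q) * indicator (L k) z) \<partial>lebesgue)"
  proof (rule nn_integral_mono)
    fix z
    show "ennreal (?h z powr q) * indicator ?v z
        \<le> (\<Sum>k. ennreal ((real k + 1) powr q * K powr q) * indicator (L k) z)" (is "_ \<le> (\<Sum>k. ?s k)")
    proof (cases "z \<in> ?v \<and> ?h z \<noteq> 0")
      case True
      \<comment> \<open>the only level that matters is the last one that is strictly exceeded\<close>
      define j where "j = nat (\<lceil>?h z / K\<rceil> - 1)"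
      have "0 < ?h z / K" using True K by simp
      then have "1 \<le> \<lceil>?h z / K\<rceil>" by linarith
      then have "real j = of_int \<lceil>?h z / K\<rceil> - 1" by (simp add: j_def)
      then have "real j < ?h z / K" "?h z / K \<le> real j + 1" by linarith+
      then have j: "real j * K < ?h z" "?h z \<le> (real j + 1) * K"
        using K by (auto simp: field_simps)
      have "ennreal (?h z powr q) \<le> ennreal (((real j + 1) * K) powr q)"
        using j q by (intro ennreal_leI powr_mono2) auto
      also have "\<dots> = ?s j"
        using j True K by (simp add: L_def powr_mult)
      also have "\<dots> \<le> (\<Sum>k. ?s k)"
      proof -
        have "g j \<le> (\<Sum>k. g k)" for g :: "nat \<Rightarrow> ennreal"
          using sum_le_suminf[of g "{j}"] by simp
        then show ?thesis .
      qed
      finally show ?thesis using True by simp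
    qed (auto simp: indicator_def)
  qed
  also have "\<dots> = (\<Sum>k. ennreal ((real k + 1) powr q * K powr q) * emeasure lebesgue (L k))"
    by (subst nn_integral_suminf) (auto simp: nn_integral_cmult_indicator)
  also have "\<dots> \<le> (\<Sum>k. ennreal ((real k + 1) powr q * (1 / 2) ^ k * (K powr q * N)))"
  proof (intro suminf_le)
    fix k
    have "measure lebesgue (L k) \<le> (1 / 2) ^ k * N"
      unfolding L_def N_def K_def
    proof (rule John_Nirenberg[OF f])
      show "(LINT z:cube y s|lebesgue. \<bar>f z - mean (cube y s) f\<bar>) \<le> M * measure lebesgue (cube y s)"
        if "0 < s" "cube y s \<subseteq> ?v" for y s
        using that by (rule bmo)
    qed (use M r in simp_all)
    then have "(real k + 1) powr q * K powr q * measure lebesgue (L k) \<le> (real k + 1) powr q * K powr q * ((1 / 2) ^ k * N)"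
      by (intro mult_left_mono) auto
    then show "ennreal ((real k + 1) powr q * K powr q) * emeasure lebesgue (L k)
        \<le> ennreal ((real k + 1) powr q * (1 / 2) ^ k * (K powr q * N))"
      unfolding emeasure_eq_measure2[OF L] by (simp add: ennreal_leI mult_ac flip: ennreal_mult)
  qed auto
  also have "\<dots> = ennreal (\<Sum>k. (real k + 1) powr q * (1 / 2) ^ k * (K powr q * N))"
    by (intro suminf_ennreal2 summable_mult2 summable_moments q) (auto simp: N_def)
  also have "(\<Sum>k. (real k + 1) powr q * (1 / 2) ^ k * (K powr q * N)) = (\<Sum>k. (real k + 1) powr q * (1 / 2) ^ k) * (K powr q * N)"
    by (intro suminf_mult2[symmetric] summable_moments q)
  finally show ?thesis by (simp add: K_def N_def mult.assoc)
qed

section \<open>Oscillations on the subcubes of a cube\<close>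

lemma set_integral_le_BMO_norm:
  fixes f :: "real ^ 'n \<Rightarrow> real"
  assumes f: "locally_integrable f" and b: "BMO_norm \<rho> \<theta> f \<le> ennreal b" "0 \<le> b"
    and r: "0 < r" and \<rho>: "0 \<le> \<rho> x"
  shows "(LINT z:cube x r|lebesgue. \<bar>f z - mean (cube x r) f\<bar>)
    \<le> (1 + r / \<rho> x) powr \<theta> * b * measure lebesgue (cube x r)"
proof -
  define w where "w = 1 + r / \<rho> x"
  define N where "N = measure lebesgue (cube x r)"
  define I where "I = (LINT z:cube x r|lebesgue. \<bar>f z - mean (cube x r) f\<bar>)"
  have w: "0 < w" using r \<rho> by (simp add: w_def add_pos_nonneg)
  have N: "0 < N" using r by (simp add: N_def measure_cube)
  have I: "0 \<le> I" by (simp add: I_def set_lebesgue_integral_def)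
  have "(\<integral>\<^sup>+z\<in>cube x r. ennreal \<bar>f z - mean (cube x r) f\<bar> \<partial>lebesgue) = ennreal I"
    unfolding I_def using locally_integrable_on_compact[OF f]
    by (intro nn_integral_eq_set_integral set_integrable_abs_diff_const) auto
  then have "eavg (cube x r) (\<lambda>y. ennreal \<bar>f y - mean (cube x r) f\<bar>) = ennreal (I / N)"
    using I N by (simp add: eavg_def emeasure_eq_measure2 divide_ennreal flip: N_def)
  moreover have "ennreal (w powr (- \<theta>)) * eavg (cube x r) (\<lambda>y. ennreal \<bar>f y - mean (cube x r) f\<bar>) \<le> BMO_norm \<rho> \<theta> f"
    unfolding BMO_norm_def w_def using r by (intro SUP_upper2[where i = x] SUP_upper2[where i = r]) auto
  ultimately have "ennreal (w powr (- \<theta>) * (I / N)) \<le> ennreal b"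
    using b(1) by (subst ennreal_mult') auto
  then have "w powr (- \<theta>) * (I / N) \<le> b" using b(2) by simp
  then show ?thesis
    using w N by (simp add: powr_minus field_simps flip: w_def N_def I_def)
qed

lemma cube_subset_cubeD:
  fixes x y :: "real ^ 'n" and r s :: real
  assumes "cube y s \<subseteq> cube x r" "0 \<le> s"
  shows "s \<le> r" "norm (x - y) \<le> CARD('n) * r"
proof -
  have *: "\<bar>y $ i + s / 2 - x $ i\<bar> \<le> r / 2" "\<bar>y $ i - s / 2 - x $ i\<bar> \<le> r / 2" "\<bar>y $ i - x $ i\<bar> \<le> r / 2" for i
  proof -
    have "y + axis i (s / 2) \<in> cube y s" "y - axis i (s / 2) \<in> cube y s" "y \<in> cube y s"
      using assms(2) by (auto simp: mem_cube axis_def)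
    then have "y + axis i (s / 2) \<in> cube x r" "y - axis i (s / 2) \<in> cube x r" "y \<in> cube x r"
      using assms(1) by auto
    then show "\<bar>y $ i + s / 2 - x $ i\<bar> \<le> r / 2" "\<bar>y $ i - s / 2 - x $ i\<bar> \<le> r / 2" "\<bar>y $ i - x $ i\<bar> \<le> r / 2"
      by (auto simp: mem_cube axis_def dest!: spec[of _ i])
  qed
  show "s \<le> r" using *(1,2)[of undefined] assms(2) by (auto simp: abs_if split: if_splits)
  then have r: "0 \<le> r" using assms(2) by simp
  have "norm (x - y) \<le> (\<Sum>i\<in>UNIV. \<bar>(x - y) $ i\<bar>)" by (rule norm_le_l1_cart)
  also have "\<dots> \<le> (\<Sum>i\<in>(UNIV :: 'n set). r)"
  proof (rule sum_mono)
    fix i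
    have "\<bar>(x - y) $ i\<bar> = \<bar>y $ i - x $ i\<bar>" by (simp add: abs_minus_commute)
    then show "\<bar>(x - y) $ i\<bar> \<le> r" using *(3)[of i] r by linarith
  qed
  finally show "norm (x - y) \<le> CARD('n) * r" by simp
qed

text \<open>The critical radius cannot take the value \<open>0\<close>, since then the middle quotient in Shen's inequality for
  \<open>y = x\<close> would be \<open>0 / 0 = 0\<close>, whereas the lower bound is positive.\<close>

lemma Shen_constants_pos:
  assumes "Shen_constants \<rho> C0 N0" "0 \<le> \<rho> x" shows "0 < \<rho> x"
proof (rule ccontr)
  assume "\<not> 0 < \<rho> x"
  then have "\<rho> x = 0" using assms(2) by simp
  moreover have "1 / C0 * (1 + norm (x - x) / \<rho> x) powr (- N0) \<le> \<rho> x / \<rho> x" "1 \<le> C0"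
    using assms(1) unfolding Shen_constants_def by blast+
  ultimately show False by (auto simp: field_simps)
qed

text \<open>The lower Shen bound gives \<open>\<rho> x / \<rho> y \<le> C0 * (1 + n * r / \<rho> x) powr N0\<close>, as the centre of a subcube is
  at distance at most \<open>n * r\<close> from \<open>x\<close>. Multiplying by \<open>r / \<rho> x\<close> costs one more power.\<close>

lemma Shen_constants_subcube:
  fixes x y :: "real ^ 'n" and r s :: real
  assumes Shen: "Shen_constants \<rho> C0 N0" and \<rho>: "\<And>x. 0 \<le> \<rho> x"
    and s: "0 < s" and sub: "cube y s \<subseteq> cube x r"
  shows "1 + s / \<rho> y \<le> C0 * CARD('n) powr N0 * (1 + r / \<rho> x) powr (N0 + 1)"
proof -
  define n where "n = real CARD('n)"
  define a where "a = r / \<rho> x"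
  have n: "1 \<le> n" by (simp add: n_def Suc_leI)
  have C0: "1 \<le> C0" "0 < N0" using Shen by (auto simp: Shen_constants_def)
  have px: "0 < \<rho> x" and py: "0 < \<rho> y" using Shen_constants_pos[OF Shen \<rho>] by auto
  have sr: "s \<le> r" and d: "norm (x - y) \<le> n * r"
    using cube_subset_cubeD[OF sub] s by (auto simp: n_def)
  have a: "0 \<le> a" using px sr s by (simp add: a_def)
  define P where "P = (1 + n * a) powr N0"
  have na: "0 \<le> n * a" using a n by simp
  have P: "1 \<le> P" unfolding P_def by (rule ge_one_powr_ge_zero) (use na C0 in auto)
  have "1 / C0 * (1 + n * a) powr (- N0) \<le> 1 / C0 * (1 + norm (x - y) / \<rho> x) powr (- N0)"
  proof -
    have "norm (x - y) / \<rho> x \<le> n * a"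
      using d px by (simp add: a_def divide_right_mono)
    then show ?thesis
      using C0 px by (intro mult_left_mono powr_mono2') (auto intro!: add_pos_nonneg)
  qed
  also have "\<dots> \<le> \<rho> y / \<rho> x" using Shen unfolding Shen_constants_def by blast
  finally have "1 / (C0 * P) \<le> \<rho> y / \<rho> x" by (simp add: P_def powr_minus_divide)
  then have "\<rho> x / \<rho> y \<le> C0 * P"
    using C0 P px py by (simp add: field_simps)
  then have "r / \<rho> x * (\<rho> x / \<rho> y) \<le> a * (C0 * P)"
    unfolding a_def[symmetric] using a by (rule mult_left_mono)
  then have "r / \<rho> y \<le> C0 * P * a" using px by (simp add: mult_ac)
  moreover have "s / \<rho> y \<le> r / \<rho> y" using sr py by (simp add: divide_right_mono)
  moreover have "1 \<le> C0 * P" using mult_mono[of 1 C0 1 P] C0 P by simp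
  ultimately have "1 + s / \<rho> y \<le> C0 * P * (1 + a)" by (simp add: algebra_simps)
  also have "P \<le> (n * (1 + a)) powr N0"
    unfolding P_def using a n C0 na by (intro powr_mono2) (auto simp: algebra_simps)
  also have "\<dots> = n powr N0 * (1 + a) powr N0" using a n by (simp add: powr_mult)
  finally show ?thesis
    using a C0 by (simp add: powr_add n_def mult_ac flip: a_def)
qed

section \<open>Weighted oscillations of functions of bounded mean oscillation\<close>

lemma wmeasure_finite:
  assumes "weight \<omega>" "compact K" shows "wmeasure \<omega> K < \<infinity>"
proof -
  have "(\<integral>\<^sup>+x\<in>K. ennreal (\<omega> x) \<partial>lebesgue) = ennreal (LINT x:K|lebesgue. \<omega> x)"
    using assms by (intro nn_integral_eq_set_integral locally_integrable_on_compact) (auto simp: weight_def)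
  then show ?thesis by (simp add: wmeasure_def)
qed

text \<open>Hoelder's inequality with the exponents \<open>(1 + \<epsilon>) / \<epsilon>\<close> and \<open>1 + \<epsilon>\<close>. The powers of the volume of the
  cube cancel, because the reciprocals of the exponents add up to \<open>1\<close>. If the weight vanishes almost everywhere on
  the cube, both integrals in the weighted oscillation are \<open>0\<close>, and so is their quotient.\<close>

lemma weighted_oscillation_le_moment:
  fixes f \<omega> :: "real ^ 'n \<Rightarrow> real" and r p \<epsilon> R G :: real
  assumes f: "locally_integrable f" and \<omega>: "weight \<omega>" and p: "1 \<le> p" and \<epsilon>: "0 < \<epsilon>" and r: "0 < r"
    and rh: "epowr (eavg (cube x r) (\<lambda>y. epowr (ennreal (\<omega> y)) (1 + \<epsilon>))) (1 / (1 + \<epsilon>))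
      \<le> ennreal R * eavg (cube x r) (\<lambda>y. ennreal (\<omega> y))" and R: "0 \<le> R" and G: "0 \<le> G"
    and moment: "(\<integral>\<^sup>+z\<in>cube x r. ennreal (\<bar>f z - mean (cube x r) f\<bar> powr (p * ((1 + \<epsilon>) / \<epsilon>))) \<partial>lebesgue)
      \<le> ennreal (G powr ((1 + \<epsilon>) / \<epsilon>) * measure lebesgue (cube x r))"
  shows "weighted_oscillation p \<omega> f (cube x r) \<le> ennreal ((G * R) powr (1 / p))"
proof -
  let ?Q = "cube x r" and ?h = "\<lambda>z. \<bar>f z - mean (cube x r) f\<bar>"
  define a where "a = (1 + \<epsilon>) / \<epsilon>"
  define b where "b = 1 + \<epsilon>"
  define N where "N = measure lebesgue ?Q"
  define X where "X = (\<integral>\<^sup>+z\<in>?Q. ennreal (?h z powr p * \<omega> z) \<partial>lebesgue)"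
  define Y where "Y = (\<integral>\<^sup>+z\<in>?Q. ennreal ((?h z powr p) powr a) \<partial>lebesgue)"
  define Z where "Z = (\<integral>\<^sup>+z\<in>?Q. ennreal (\<omega> z powr b) \<partial>lebesgue)"
  have ab: "1 < a" "1 < b" "1 / a + 1 / b = 1"
    using \<epsilon> by (auto simp: a_def b_def field_simps)
  have N: "0 < N" "emeasure lebesgue ?Q = ennreal N"
  proof -
    show "0 < N" using r by (simp add: N_def measure_cube)
    show "emeasure lebesgue ?Q = ennreal N"
      unfolding N_def by (rule emeasure_eq_measure2) simp
  qed
  have \<omega>0: "0 \<le> \<omega> z" for z using \<omega> by (simp add: weight_def)
  have [measurable]: "f \<in> borel_measurable lebesgue" "\<omega> \<in> borel_measurable lebesgue"
    using f \<omega> by (auto simp: weight_def intro: locally_integrable_measurable)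
  obtain W where W: "wmeasure \<omega> ?Q = ennreal W" "0 \<le> W"
    using wmeasure_finite[OF \<omega> compact_cube[of x r]] by (cases "wmeasure \<omega> ?Q") auto
  have avg: "eavg ?Q (\<lambda>y. ennreal (\<omega> y)) = ennreal (W / N)"
    using W N by (simp add: eavg_def wmeasure_def divide_ennreal)
  have Y: "epowr Y (1 / a) \<le> ennreal (G * N powr (1 / a))"
  proof -
    have "Y \<le> ennreal (G powr a * N)" using moment unfolding Y_def a_def N_def powr_powr .
    then have "epowr Y (1 / a) \<le> epowr (ennreal (G powr a * N)) (1 / a)"
      using ab by (intro epowr_mono) auto
    also have "\<dots> = ennreal (G * N powr (1 / a))"
      using ab G N by (simp add: epowr_ennreal powr_mult powr_powr)
    finally show ?thesis .
  qed
  have Z: "epowr Z (1 / b) \<le> ennreal (R * (W / N) * N powr (1 / b))"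
  proof -
    have "(\<integral>\<^sup>+y\<in>?Q. epowr (ennreal (\<omega> y)) (1 + \<epsilon>) \<partial>lebesgue) = Z"
      using ab \<omega>0 by (simp add: Z_def b_def epowr_ennreal)
    then have "Z = eavg ?Q (\<lambda>y. epowr (ennreal (\<omega> y)) (1 + \<epsilon>)) * ennreal N"
      using N by (simp add: eavg_def ennreal_divide_mult_cancel)
    then have "epowr Z (1 / b) = epowr (eavg ?Q (\<lambda>y. epowr (ennreal (\<omega> y)) (1 + \<epsilon>))) (1 / b) * epowr (ennreal N) (1 / b)"
      using ab by (simp add: epowr_mult)
    also have "\<dots> \<le> (ennreal R * ennreal (W / N)) * epowr (ennreal N) (1 / b)"
      using rh unfolding avg b_def by (intro mult_right_mono) auto
    also have "\<dots> = ennreal (R * (W / N) * N powr (1 / b))"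
      using ab N R W by (simp add: epowr_ennreal mult.assoc flip: ennreal_mult)
    finally show ?thesis .
  qed
  have "X \<le> epowr Y (1 / a) * epowr Z (1 / b)"
    unfolding X_def Y_def Z_def using ab \<omega>0 by (intro Hoelder_set_nn_integral) auto
  also have "\<dots> \<le> ennreal (G * N powr (1 / a)) * ennreal (R * (W / N) * N powr (1 / b))"
    by (intro mult_mono Y Z) auto
  also have "\<dots> = ennreal (G * R * W * (N powr (1 / a + 1 / b) / N))"
    using G R W N by (simp add: powr_add mult_ac flip: ennreal_mult)
  also have "N powr (1 / a + 1 / b) / N = 1" using N ab by simp
  finally have X: "X \<le> ennreal (G * R * W)" by simp
  have "X / ennreal W \<le> ennreal (G * R)"
  proof (cases "W = 0")
    case True
    with X show ?thesis by (simp add: divide_ennreal_def)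
  next
    case False
    have "X / ennreal W \<le> ennreal (G * R * W) / ennreal W" by (intro divide_right_mono_ennreal X)
    also have "\<dots> = ennreal (G * R)" using False W G R by (simp add: divide_ennreal)
    finally show ?thesis .
  qed
  then have "epowr (X / ennreal W) (1 / p) \<le> epowr (ennreal (G * R)) (1 / p)"
    using p by (intro epowr_mono) auto
  also have "\<dots> = ennreal ((G * R) powr (1 / p))" using p G R by (simp add: epowr_ennreal)
  finally show ?thesis by (simp add: weighted_oscillation_def W X_def)
qed

text \<open>The bound is stated for every positive \<open>b\<close> above the norm, since the John--Nirenberg
  inequality needs a positive bound on the oscillations and the norm may be \<open>0\<close>.\<close>

lemma weighted_oscillation_le_BMO_bound:
  fixes \<rho> \<omega> :: "real ^ 'n \<Rightarrow> real" and p \<theta> N0 \<eta> C0 :: real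
  assumes Shen: "Shen_constants \<rho> C0 N0" and \<rho>: "\<And>x. 0 \<le> \<rho> x"
    and \<omega>: "weight \<omega>" and rh: "reverse_Hoelder_exponent \<rho> \<omega> \<eta>" and p: "1 \<le> p" and \<theta>: "0 < \<theta>"
  shows "\<exists>C>0. \<forall>f. locally_integrable f \<longrightarrow> (\<forall>b>0. BMO_norm \<rho> \<theta> f \<le> ennreal b \<longrightarrow>
      (\<forall>x. \<forall>r>0. weighted_oscillation p \<omega> f (cube x r)
        \<le> ennreal (C * (1 + r / \<rho> x) powr ((N0 + 1) * \<theta> + \<eta> / p) * b)))"
proof -
  obtain \<epsilon> K where \<epsilon>: "0 < \<epsilon>" and K: "0 < K"
    and rh': "\<And>x r. 0 < r \<Longrightarrow> epowr (eavg (cube x r) (\<lambda>y. epowr (ennreal (\<omega> y)) (1 + \<epsilon>))) (1 / (1 + \<epsilon>))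
      \<le> ennreal K * eavg (cube x r) (\<lambda>y. ennreal (\<omega> y)) * ennreal ((1 + r / \<rho> x) powr \<eta>)"
    using rh unfolding reverse_Hoelder_exponent_def by blast
  have C0: "1 \<le> C0" "0 < N0" using Shen by (auto simp: Shen_constants_def)
  define a where "a = (1 + \<epsilon>) / \<epsilon>"
  define A where "A = (\<Sum>k. (real k + 1) powr (p * a) * (1 / 2) ^ k)"
  define c where "c = (C0 * CARD('n) powr N0) powr \<theta>"
  define \<kappa> where "\<kappa> = 2 + 2 ^ CARD('n) * (1 :: real)"
  define C where "C = A powr (1 / a / p) * \<kappa> * c * K powr (1 / p)"
  have a: "0 < a" "0 < p * a" using \<epsilon> p by (auto simp: a_def)
  have A: "0 < A" unfolding A_def by (intro suminf_pos summable_moments a) auto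
  have c: "0 < c" using C0 by (simp add: c_def)
  have \<kappa>: "0 < \<kappa>" by (simp add: \<kappa>_def add_pos_pos)
  have "0 < C" using A c \<kappa> K by (simp add: C_def)
  moreover have "weighted_oscillation p \<omega> f (cube x r)
        \<le> ennreal (C * (1 + r / \<rho> x) powr ((N0 + 1) * \<theta> + \<eta> / p) * b)"
    if f: "locally_integrable f" and b: "0 < b" "BMO_norm \<rho> \<theta> f \<le> ennreal b" and r: "0 < r" for f b x r
  proof -
    define w where "w = 1 + r / \<rho> x"
    define M where "M = c * w powr ((N0 + 1) * \<theta>) * b"
    have w: "1 \<le> w" using r \<rho>[of x] by (simp add: w_def)
    have M: "0 < M" using c w b by (simp add: M_def)
    define G where "G = A powr (1 / a) * (\<kappa> * M) powr p"
    define R where "R = K * w powr \<eta>"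
    have bmo: "(LINT z:cube y s|lebesgue. \<bar>f z - mean (cube y s) f\<bar>) \<le> M * measure lebesgue (cube y s)"
      if s: "0 < s" and sub: "cube y s \<subseteq> cube x r" for y s
    proof -
      have "(1 + s / \<rho> y) powr \<theta> \<le> (C0 * CARD('n) powr N0 * w powr (N0 + 1)) powr \<theta>"
        unfolding w_def using Shen_constants_subcube[OF Shen \<rho> s sub] s \<rho>[of y] \<theta>
        by (intro powr_mono2) auto
      also have "\<dots> = c * w powr ((N0 + 1) * \<theta>)"
        using C0 w by (simp add: c_def powr_mult powr_powr)
      finally have "(1 + s / \<rho> y) powr \<theta> * b * measure lebesgue (cube y s) \<le> M * measure lebesgue (cube y s)"
        unfolding M_def using b by (intro mult_right_mono) auto
      with set_integral_le_BMO_norm[OF f b(2) _ s \<rho>[of y]] b show ?thesis by simp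
    qed
    have "weighted_oscillation p \<omega> f (cube x r) \<le> ennreal ((G * R) powr (1 / p))"
    proof (rule weighted_oscillation_le_moment[OF f \<omega> p \<epsilon> r])
      show "epowr (eavg (cube x r) (\<lambda>y. epowr (ennreal (\<omega> y)) (1 + \<epsilon>))) (1 / (1 + \<epsilon>))
          \<le> ennreal R * eavg (cube x r) (\<lambda>y. ennreal (\<omega> y))"
        using rh'[OF r, of x] K by (simp add: R_def w_def ennreal_mult mult_ac)
      show "(\<integral>\<^sup>+z\<in>cube x r. ennreal (\<bar>f z - mean (cube x r) f\<bar> powr (p * ((1 + \<epsilon>) / \<epsilon>))) \<partial>lebesgue)
          \<le> ennreal (G powr ((1 + \<epsilon>) / \<epsilon>) * measure lebesgue (cube x r))"
      proof -
        have "(\<integral>\<^sup>+z\<in>cube x r. ennreal (\<bar>f z - mean (cube x r) f\<bar> powr (p * a)) \<partial>lebesgue)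
            \<le> ennreal (A * ((2 + 2 ^ CARD('n)) * M) powr (p * a) * measure lebesgue (cube x r))"
          unfolding A_def
          using locally_integrable_on_compact[OF f compact_cube] bmo M r a(2)
          by (rule John_Nirenberg_moment)
        also have "A * ((2 + 2 ^ CARD('n)) * M) powr (p * a) = G powr a"
          using A a M \<kappa> by (simp add: G_def powr_mult powr_powr \<kappa>_def)
        finally show ?thesis by (simp only: a_def)
      qed
    qed (use K in \<open>auto simp: R_def G_def\<close>)
    also have "(G * R) powr (1 / p) = C * w powr ((N0 + 1) * \<theta> + \<eta> / p) * b"
    proof -
      have "(G * R) powr (1 / p) = A powr (1 / a / p) * (\<kappa> * M) * (K powr (1 / p) * w powr (\<eta> / p))"
        using A \<kappa> M K w p by (simp add: G_def R_def powr_mult powr_powr)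
      then show ?thesis by (simp add: M_def C_def powr_add mult_ac)
    qed
    finally show ?thesis by (simp add: w_def)
  qed
  ultimately show ?thesis by blast
qed

section \<open>Muckenhoupt weights\<close>

text \<open>The \<open>A\<^sub>p\<close> quantity of a single set, whose supremum over balls, damped by the critical radius, is the
  \<open>A\<^sub>p\<close> constant.\<close>

definition Ap_ratio :: "real \<Rightarrow> (real ^ 'n \<Rightarrow> real) \<Rightarrow> (real ^ 'n) set \<Rightarrow> ennreal" where
  "Ap_ratio p \<omega> B =
     (if p = 1
      then eavg B (\<lambda>y. ennreal (\<omega> y)) * inverse (ess_inf_on B (\<lambda>y. ennreal (\<omega> y)))
      else epowr (eavg B (\<lambda>y. ennreal (\<omega> y))) (1 / p) *
        epowr (eavg B (\<lambda>y. epowr (ennreal (\<omega> y)) (- (p / (p - 1)) / p))) (1 / (p / (p - 1))))"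

lemma Ap_const_eq:
  "Ap_const \<rho> \<theta> p \<omega> = (SUP x. SUP r\<in>{0<..}. ennreal ((1 + r / \<rho> x) powr (- \<theta>)) * Ap_ratio p \<omega> (ball x r))"
  unfolding Ap_const_def Ap_ratio_def Let_def ..

lemma Ap_ratio_le_Ap_const:
  assumes r: "0 < r" and \<rho>: "0 \<le> \<rho> x"
  shows "Ap_ratio p \<omega> (ball x r) \<le> ennreal ((1 + r / \<rho> x) powr \<theta>) * Ap_const \<rho> \<theta> p \<omega>"
proof -
  define w where "w = 1 + r / \<rho> x"
  have w: "0 < w" using r \<rho> by (simp add: w_def add_pos_nonneg)
  have "ennreal (w powr (- \<theta>)) * Ap_ratio p \<omega> (ball x r) \<le> Ap_const \<rho> \<theta> p \<omega>"
    unfolding Ap_const_eq w_def using r by (intro SUP_upper2[where i = x] SUP_upper2[where i = r]) auto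
  then have "ennreal (w powr \<theta>) * (ennreal (w powr (- \<theta>)) * Ap_ratio p \<omega> (ball x r)) \<le> ennreal (w powr \<theta>) * Ap_const \<rho> \<theta> p \<omega>"
    by (rule mult_left_mono) simp
  also have "ennreal (w powr \<theta>) * (ennreal (w powr (- \<theta>)) * Ap_ratio p \<omega> (ball x r)) = Ap_ratio p \<omega> (ball x r)"
    using w by (simp add: mult.assoc[symmetric] ennreal_mult[symmetric] powr_add[symmetric])
  finally show ?thesis by (simp add: w_def)
qed

lemma emeasure_ball_pos_finite:
  fixes x :: "'a::euclidean_space"
  assumes "0 < r" obtains N where "0 < N" "emeasure lebesgue (ball x r) = ennreal N"
proof
  show "emeasure lebesgue (ball x r) = ennreal (measure lebesgue (ball x r))"
    by (rule emeasure_eq_measure2) simp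
  show "0 < measure lebesgue (ball x r)"
    using content_ball_pos[OF assms, of x] by (simp add: measure_completion)
qed

text \<open>On a ball that meets the zero set of a weight in positive measure, but on which the weight
  does not vanish almost everywhere, the first factor of the Muckenhoupt quantity is positive and
  the second one is infinite.\<close>

lemma Ap_ratio_eq_top:
  fixes \<omega> :: "real ^ 'n \<Rightarrow> real"
  assumes [measurable]: "\<omega> \<in> borel_measurable lebesgue" and nonneg: "\<And>y. 0 \<le> \<omega> y" and p: "1 \<le> p" and r: "0 < r"
    and zero: "\<not> (AE y\<in>ball x r in lebesgue. \<omega> y \<noteq> 0)"
    and nonzero: "\<not> (AE y\<in>ball x r in lebesgue. \<omega> y = 0)"
  shows "Ap_ratio p \<omega> (ball x r) = \<infinity>"
proof -
  let ?B = "ball x r"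
  have [measurable]: "?B \<in> sets lebesgue" by simp
  obtain N where N: "0 < N" "emeasure lebesgue ?B = ennreal N"
    using emeasure_ball_pos_finite[OF r] .
  have "(\<integral>\<^sup>+y\<in>?B. ennreal (\<omega> y) \<partial>lebesgue) \<noteq> 0"
  proof
    assume "(\<integral>\<^sup>+y\<in>?B. ennreal (\<omega> y) \<partial>lebesgue) = 0"
    then have "AE y in lebesgue. ennreal (\<omega> y) * indicator ?B y = 0"
      by (subst (asm) nn_integral_0_iff_AE) auto
    then have "AE y\<in>?B in lebesgue. \<omega> y = 0"
      by eventually_elim (use nonneg in \<open>auto simp: ennreal_eq_0_iff intro: antisym\<close>)
    with nonzero show False by simp
  qed
  then have avg: "eavg ?B (\<lambda>y. ennreal (\<omega> y)) \<noteq> 0"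
    using N by (simp add: eavg_def ennreal_divide_eq_0_iff)
  show ?thesis
  proof (cases "p = 1")
    case True
    have "c = 0" if c: "AE y\<in>?B in lebesgue. c \<le> ennreal (\<omega> y)" for c
    proof (rule ccontr)
      assume "c \<noteq> 0"
      from c have "AE y\<in>?B in lebesgue. \<omega> y \<noteq> 0"
        by eventually_elim (use \<open>c \<noteq> 0\<close> in auto)
      with zero show False by simp
    qed
    then have "ess_inf_on ?B (\<lambda>y. ennreal (\<omega> y)) \<le> 0"
      unfolding ess_inf_on_def by (intro Sup_least) blast
    then have "ess_inf_on ?B (\<lambda>y. ennreal (\<omega> y)) = 0" by simp
    with avg True show ?thesis by (simp add: Ap_ratio_def ennreal_mult_top)
  next
    case False
    define t where "t = (p / (p - 1)) / p"
    have t: "0 < t" using p False by (simp add: t_def)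
    define Z where "Z = {y \<in> space lebesgue. y \<in> ?B \<and> \<omega> y = 0}"
    have [measurable]: "Z \<in> sets lebesgue" unfolding Z_def by measurable
    have "emeasure lebesgue Z \<noteq> 0"
    proof
      assume "emeasure lebesgue Z = 0"
      then have "AE y in lebesgue. y \<notin> Z"
        by (intro AE_not_in) auto
      then have "AE y\<in>?B in lebesgue. \<omega> y \<noteq> 0" by eventually_elim (auto simp: Z_def)
      with zero show False by simp
    qed
    then have "\<infinity> = (\<integral>\<^sup>+y. \<infinity> * indicator Z y \<partial>lebesgue)"
      by (subst nn_integral_cmult_indicator) (simp_all add: ennreal_top_mult del: emeasure_completion)
    also have "\<dots> \<le> (\<integral>\<^sup>+y\<in>?B. epowr (ennreal (\<omega> y)) (- t) \<partial>lebesgue)"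
      using t by (intro nn_integral_mono) (auto simp: Z_def indicator_def epowr_def)
    finally have "eavg ?B (\<lambda>y. epowr (ennreal (\<omega> y)) (- t)) = \<infinity>"
      using N by (simp add: eavg_def top_unique ennreal_top_divide)
    moreover have "epowr (eavg ?B (\<lambda>y. ennreal (\<omega> y))) (1 / p) \<noteq> 0"
      using avg p by (cases "eavg ?B (\<lambda>y. ennreal (\<omega> y))")
        (auto simp: epowr_ennreal epowr_top[unfolded infinity_ennreal_def] ennreal_eq_0_iff powr_def split: if_splits)
    moreover have "0 < 1 / (p / (p - 1))" using p False by simp
    ultimately show ?thesis
      using False epowr_top[of "1 / (p / (p - 1))"]
      by (simp add: Ap_ratio_def t_def ennreal_mult_top)
  qed
qed

text \<open>Otherwise a large enough ball meets the zero set of the weight in positive measure and also carries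
  some mass of the weight, so that the \<open>A\<^sub>p\<close> quantity of this ball is infinite.\<close>

lemma Ap_class_AE_pos:
  fixes \<omega> :: "real ^ 'n \<Rightarrow> real"
  assumes \<omega>: "\<omega> \<in> Ap_class \<rho> \<theta> p" and p: "1 \<le> p" and \<rho>: "\<And>x. 0 \<le> \<rho> x"
  shows "AE y in lebesgue. 0 < \<omega> y"
proof (rule ccontr)
  assume *: "\<not> (AE y in lebesgue. 0 < \<omega> y)"
  have w: "weight \<omega>" and fin: "Ap_const \<rho> \<theta> p \<omega> < \<infinity>" using \<omega> by (auto simp: Ap_class_def)
  then have nonneg: "0 \<le> \<omega> y" for y by (simp add: weight_def)
  have meas: "\<omega> \<in> borel_measurable lebesgue"
    using w by (simp add: weight_def locally_integrable_measurable)
  have AE_balls: "AE y in lebesgue. P y" if "\<And>k. AE y\<in>ball 0 (real k) in lebesgue. P y" for P :: "real ^ 'n \<Rightarrow> bool"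
  proof -
    have "AE y in lebesgue. \<forall>k. y \<in> ball 0 (real k) \<longrightarrow> P y"
      using that by (subst AE_all_countable) auto
    then show ?thesis
    proof eventually_elim
      case (elim y)
      obtain k where "norm y < real k" using reals_Archimedean2 by blast
      with elim show "P y" by auto
    qed
  qed
  have "\<not> (AE y in lebesgue. \<omega> y \<noteq> 0)"
  proof
    assume "AE y in lebesgue. \<omega> y \<noteq> 0"
    then have "AE y in lebesgue. 0 < \<omega> y"
      by eventually_elim (use nonneg in \<open>simp add: less_le\<close>)
    with * show False ..
  qed
  then obtain k where k: "\<not> (AE y\<in>ball 0 (real k) in lebesgue. \<omega> y \<noteq> 0)"
    using AE_balls[of "\<lambda>y. \<omega> y \<noteq> 0"] by blast
  have "\<not> (AE y in lebesgue. \<omega> y = 0)" using w by (simp add: weight_def)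
  then obtain l where l: "\<not> (AE y\<in>ball 0 (real l) in lebesgue. \<omega> y = 0)"
    using AE_balls[of "\<lambda>y. \<omega> y = 0"] by blast
  define R where "R = real (max k l) + 1"
  have R: "0 < R" "ball (0 :: real ^ 'n) (real k) \<subseteq> ball 0 R" "ball (0 :: real ^ 'n) (real l) \<subseteq> ball 0 R"
    by (auto simp: R_def)
  have "Ap_ratio p \<omega> (ball 0 R) = \<infinity>"
  proof (rule Ap_ratio_eq_top[OF meas nonneg p R(1)])
    show "\<not> (AE y\<in>ball 0 R in lebesgue. \<omega> y \<noteq> 0)"
    proof
      assume "AE y\<in>ball 0 R in lebesgue. \<omega> y \<noteq> 0"
      then have "AE y\<in>ball 0 (real k) in lebesgue. \<omega> y \<noteq> 0"
        by eventually_elim (use R in blast)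
      with k show False ..
    qed
    show "\<not> (AE y\<in>ball 0 R in lebesgue. \<omega> y = 0)"
    proof
      assume "AE y\<in>ball 0 R in lebesgue. \<omega> y = 0"
      then have "AE y\<in>ball 0 (real l) in lebesgue. \<omega> y = 0"
        by eventually_elim (use R in blast)
      with l show False ..
    qed
  qed
  with Ap_ratio_le_Ap_const[where \<rho> = \<rho> and x = 0 and p = p and \<omega> = \<omega> and \<theta> = \<theta>, OF R(1) \<rho>] fin
  show False by (auto simp: top_unique ennreal_mult_eq_top_iff)
qed

lemma cube_subset_ball:
  fixes x :: "real ^ 'n" and r :: real
  assumes r: "0 < r" shows "cube x r \<subseteq> ball x (CARD('n) * r)"
proof
  fix z assume z: "z \<in> cube x r"
  have "norm (z - x) \<le> (\<Sum>i\<in>UNIV. \<bar>(z - x) $ i\<bar>)" by (rule norm_le_l1_cart)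
  also have "\<dots> \<le> (\<Sum>i\<in>(UNIV :: 'n set). r / 2)"
    using z by (intro sum_mono) (simp add: mem_cube)
  also have "\<dots> < CARD('n) * r" using r by simp
  finally show "z \<in> ball x (CARD('n) * r)" by (simp add: dist_norm norm_minus_commute)
qed

text \<open>The cube lies in the ball, and the ball lies in the concentric cube of side \<open>2 * n * r\<close>, which has
  \<open>(2 * n) ^ n\<close> times the volume of the smaller cube.\<close>

lemma eavg_cube_le_ball:
  fixes x :: "real ^ 'n" and r :: real
  assumes r: "0 < r"
  shows "eavg (cube x r) h \<le> ennreal ((2 * CARD('n)) ^ CARD('n)) * eavg (ball x (CARD('n) * r)) h"
proof -
  define n where "n = CARD('n)"
  let ?Q = "cube x r" and ?B = "ball x (real n * r)"
  define K where "K = real ((2 * n) ^ n)"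
  have n: "0 < n" "0 < real n * r" using r by (auto simp: n_def)
  obtain N where N: "0 < N" "emeasure lebesgue ?B = ennreal N"
    using emeasure_ball_pos_finite[OF n(2)] .
  have sub: "?Q \<subseteq> ?B"
    unfolding n_def by (rule cube_subset_ball[OF r])
  have "?B \<subseteq> cube x (2 * (real n * r))"
  proof
    fix z assume "z \<in> ?B"
    then have "norm (z - x) \<le> real n * r" by (simp add: dist_norm norm_minus_commute)
    then have "\<bar>(z - x) $ i\<bar> \<le> real n * r" for i
      using component_le_norm_cart[of "z - x" i] by linarith
    then show "z \<in> cube x (2 * (real n * r))" by (simp add: mem_cube)
  qed
  then have "emeasure lebesgue ?B \<le> emeasure lebesgue (cube x (2 * (real n * r)))"
    by (rule emeasure_mono) simp
  also have "\<dots> = ennreal (K * r ^ n)"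
    using n by (subst emeasure_cube) (auto simp: K_def n_def power_mult_distrib mult.assoc)
  finally have "ennreal N \<le> ennreal (K * r ^ n)" using N by simp
  moreover have "0 \<le> K * r ^ n" using r by (simp add: K_def)
  ultimately have NK: "N \<le> K * r ^ n" by (simp only: ennreal_le_iff)
  have "eavg ?Q h \<le> (\<integral>\<^sup>+y\<in>?B. h y \<partial>lebesgue) / ennreal (r ^ n)"
    unfolding eavg_def using r sub by (subst emeasure_cube)
      (auto simp: n_def intro!: divide_right_mono_ennreal nn_integral_mono split: split_indicator)
  also have "\<dots> \<le> (\<integral>\<^sup>+y\<in>?B. h y \<partial>lebesgue) * ennreal (K / N)"
  proof -
    have "inverse (r ^ n) \<le> K / N" using r N NK by (simp add: field_simps)
    then show ?thesis
      using r by (auto simp: divide_ennreal_def inverse_ennreal intro!: mult_left_mono ennreal_leI)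
  qed
  also have "\<dots> = ennreal K * eavg ?B h"
    using N by (simp add: eavg_def divide_ennreal_def inverse_ennreal ennreal_mult divide_inverse mult_ac K_def)
  finally show ?thesis by (simp add: K_def n_def)
qed

lemma wmeasure_pos:
  fixes \<omega> :: "real ^ 'n \<Rightarrow> real"
  assumes [measurable]: "\<omega> \<in> borel_measurable lebesgue" "S \<in> sets lebesgue"
    and pos: "AE y in lebesgue. 0 < \<omega> y" and S: "emeasure lebesgue S \<noteq> 0"
  shows "wmeasure \<omega> S \<noteq> 0"
proof
  assume "wmeasure \<omega> S = 0"
  then have "AE y in lebesgue. ennreal (\<omega> y) * indicator S y = 0"
    unfolding wmeasure_def by (subst (asm) nn_integral_0_iff_AE) auto
  with pos have "AE y in lebesgue. y \<notin> S"
    by eventually_elim (auto simp: ennreal_eq_0_iff indicator_def split: if_splits)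
  then have "emeasure lebesgue S = 0"
    by (subst (asm) AE_iff_measurable[of S]) (auto simp: emeasure_completion)
  with S show False ..
qed

text \<open>For \<open>p > 1\<close> this is Hoelder's inequality for \<open>\<bar>f - f\<^sub>Q\<bar> * \<omega> powr (1 / p)\<close> and
  \<open>\<omega> powr (- 1 / p)\<close>. For \<open>p = 1\<close> the weight is bounded below by its essential infimum \<open>m\<close> on the ball;
  finiteness of the \<open>A\<^sub>1\<close> quantity excludes \<open>m = 0\<close>, so one may divide by \<open>m\<close>. The volume factor
  appears with the exponent \<open>1 / p + 1 / p' = 1\<close>.\<close>

lemma oscillation_le_Ap_ratio:
  fixes f \<omega> :: "real ^ 'n \<Rightarrow> real" and r p :: real
  assumes f: "locally_integrable f" and \<omega>: "weight \<omega>" and pos: "AE y in lebesgue. 0 < \<omega> y"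
    and p: "1 \<le> p" and r: "0 < r"
    and fin: "Ap_ratio p \<omega> (ball x (CARD('n) * r)) < \<infinity>"
  shows "eavg (cube x r) (\<lambda>y. ennreal \<bar>f y - mean (cube x r) f\<bar>)
    \<le> weighted_oscillation p \<omega> f (cube x r) *
      (ennreal ((2 * CARD('n)) ^ CARD('n)) * Ap_ratio p \<omega> (ball x (CARD('n) * r)))"
proof -
  let ?Q = "cube x r" and ?B = "ball x (real CARD('n) * r)" and ?h = "\<lambda>z. \<bar>f z - mean (cube x r) f\<bar>"
  define K where "K = real ((2 * CARD('n)) ^ CARD('n))"
  define N where "N = measure lebesgue ?Q"
  define X where "X = (\<integral>\<^sup>+z\<in>?Q. ennreal (?h z powr p * \<omega> z) \<partial>lebesgue)"
  define J where "J = (\<integral>\<^sup>+z\<in>?Q. ennreal (?h z) \<partial>lebesgue)"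
  have N: "0 < N" "emeasure lebesgue ?Q = ennreal N"
  proof -
    show "0 < N" using r by (simp add: N_def measure_cube)
    show "emeasure lebesgue ?Q = ennreal N"
      unfolding N_def by (rule emeasure_eq_measure2) simp
  qed
  have K: "0 < K" by (simp add: K_def)
  have \<omega>0: "0 \<le> \<omega> z" for z using \<omega> by (simp add: weight_def)
  have [measurable]: "f \<in> borel_measurable lebesgue" "\<omega> \<in> borel_measurable lebesgue"
    using f \<omega> by (auto simp: weight_def intro: locally_integrable_measurable)
  have to_ball: "eavg ?Q g \<le> ennreal K * eavg ?B g" for g
    using eavg_cube_le_ball[OF r, of x g] by (simp only: K_def)
  have "wmeasure \<omega> ?Q \<noteq> 0"
    using N by (intro wmeasure_pos pos) auto
  then obtain W where W: "wmeasure \<omega> ?Q = ennreal W" "0 < W"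
    using wmeasure_finite[OF \<omega> compact_cube[of x r]] by (cases "wmeasure \<omega> ?Q") (auto simp: less_le)
  have avg: "eavg ?Q (\<lambda>y. ennreal (\<omega> y)) = ennreal (W / N)"
    using W N by (simp add: eavg_def wmeasure_def divide_ennreal)
  have times_N: "eavg ?Q g * ennreal N = (\<integral>\<^sup>+z\<in>?Q. g z \<partial>lebesgue)" for g
    using N by (simp add: eavg_def ennreal_divide_mult_cancel)
  have XW: "X / ennreal W * ennreal W = X"
    using W by (simp add: ennreal_divide_mult_cancel)
  have cancel: "J / ennreal N \<le> c" if "J \<le> c * ennreal N" for c
  proof -
    have "J / ennreal N \<le> c * ennreal N / ennreal N" using that by (rule divide_right_mono_ennreal)
    also have "\<dots> = c" using N by (simp add: ennreal_mult_divide_eq)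
    finally show ?thesis .
  qed
  have "J / ennreal N \<le> weighted_oscillation p \<omega> f ?Q * (ennreal K * Ap_ratio p \<omega> ?B)"
  proof (cases "p = 1")
    case True
    define m where "m = ess_inf_on ?B (\<lambda>y. ennreal (\<omega> y))"
    have osc: "weighted_oscillation p \<omega> f ?Q * ennreal W = X"
      using True XW by (simp add: weighted_oscillation_def W(1) X_def epowr_one)
    have lower: "c * J \<le> X" "c * ennreal N \<le> ennreal W" if c: "AE y\<in>?B in lebesgue. c \<le> ennreal (\<omega> y)" for c
    proof -
      have "AE z in lebesgue. z \<in> ?Q \<longrightarrow> c \<le> ennreal (\<omega> z)"
        using c by eventually_elim (use cube_subset_ball[OF r, of x] in blast)
      then have "AE z in lebesgue. c * (ennreal (?h z) * indicator ?Q z) \<le> ennreal (?h z powr p * \<omega> z) * indicator ?Q z"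
        and "AE z in lebesgue. c * indicator ?Q z \<le> ennreal (\<omega> z) * indicator ?Q z"
        using True \<omega>0
        by (auto elim!: eventually_mono simp: ennreal_mult' mult.commute indicator_def intro: mult_right_mono)
      then have "(\<integral>\<^sup>+z. c * (ennreal (?h z) * indicator ?Q z) \<partial>lebesgue) \<le> X"
        and "(\<integral>\<^sup>+z. c * indicator ?Q z \<partial>lebesgue) \<le> wmeasure \<omega> ?Q"
        unfolding X_def wmeasure_def by (auto intro: nn_integral_mono_AE)
      then show "c * J \<le> X" "c * ennreal N \<le> ennreal W"
        unfolding W(1) N(2)[symmetric] J_def
        by (auto simp: nn_integral_cmult nn_integral_cmult_indicator simp del: emeasure_completion)
    qed
    have "m * J \<le> X"
      unfolding m_def ess_inf_on_def using lower(1) by (subst SUP_mult_right_ennreal[of "\<lambda>c. c", simplified]) (auto intro!: SUP_least)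
    have "m \<le> ennreal (W / N)"
      unfolding m_def ess_inf_on_def
    proof (rule Sup_least, clarify)
      fix c assume "AE y\<in>?B in lebesgue. c \<le> ennreal (\<omega> y)"
      then have "c * ennreal N / ennreal N \<le> ennreal W / ennreal N"
        by (intro divide_right_mono_ennreal lower(2))
      then show "c \<le> ennreal (W / N)" using N W by (simp add: ennreal_mult_divide_eq divide_ennreal)
    qed
    then have m_fin: "m \<noteq> \<infinity>" by (auto simp: top_unique)
    have "eavg ?B (\<lambda>y. ennreal (\<omega> y)) \<noteq> 0"
      using to_ball[of "\<lambda>y. ennreal (\<omega> y)"] W N unfolding avg by auto
    then have "m \<noteq> 0"
      using fin True by (auto simp: Ap_ratio_def m_def[symmetric] ennreal_mult_top)
    with m_fin have m: "m * inverse m = 1"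
      by (cases m) (auto simp: inverse_ennreal less_le simp flip: ennreal_mult)
    have "J = (m * J) * inverse m" using m by (simp add: mult_ac)
    also have "\<dots> \<le> X * inverse m" using \<open>m * J \<le> X\<close> by (rule mult_right_mono) simp
    also have "X = weighted_oscillation p \<omega> f ?Q * (eavg ?Q (\<lambda>y. ennreal (\<omega> y)) * ennreal N)"
      unfolding times_N osc[symmetric] W(1)[symmetric] wmeasure_def ..
    also have "\<dots> * inverse m = weighted_oscillation p \<omega> f ?Q * (eavg ?Q (\<lambda>y. ennreal (\<omega> y)) * inverse m) * ennreal N"
      by (simp add: mult_ac)
    finally have "J / ennreal N \<le> weighted_oscillation p \<omega> f ?Q * (eavg ?Q (\<lambda>y. ennreal (\<omega> y)) * inverse m)"
      by (rule cancel)
    also have "\<dots> \<le> weighted_oscillation p \<omega> f ?Q * (ennreal K * eavg ?B (\<lambda>y. ennreal (\<omega> y)) * inverse m)"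
      by (intro mult_mono to_ball) auto
    also have "\<dots> = weighted_oscillation p \<omega> f ?Q * (ennreal K * Ap_ratio p \<omega> ?B)"
      using True by (simp add: Ap_ratio_def m_def mult_ac)
    finally show ?thesis .
  next
    case False
    then have p1: "1 < p" using p by simp
    define q where "q = p / (p - 1)"
    have q: "1 < q" "1 / p + 1 / q = 1" using p1 by (auto simp: q_def field_simps)
    define Z where "Z = eavg ?Q (\<lambda>y. epowr (ennreal (\<omega> y)) (- q / p))"
    define T where "T = weighted_oscillation p \<omega> f ?Q"
    have T: "T * epowr (ennreal W) (1 / p) = epowr X (1 / p)"
    proof -
      have "epowr (X / ennreal W) (1 / p) * epowr (ennreal W) (1 / p) = epowr (X / ennreal W * ennreal W) (1 / p)"
        using p1 by (subst epowr_mult) auto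
      then show ?thesis by (simp only: T_def weighted_oscillation_def W(1) X_def XW[unfolded X_def])
    qed
    have "J = (\<integral>\<^sup>+z\<in>?Q. ennreal ((?h z * \<omega> z powr (1 / p)) * \<omega> z powr (- (1 / p))) \<partial>lebesgue)"
      unfolding J_def using pos
      by (intro nn_integral_cong_AE, eventually_elim) (simp add: powr_minus field_simps)
    also have "\<dots> \<le> epowr (\<integral>\<^sup>+z\<in>?Q. ennreal ((?h z * \<omega> z powr (1 / p)) powr p) \<partial>lebesgue) (1 / p) *
        epowr (\<integral>\<^sup>+z\<in>?Q. ennreal ((\<omega> z powr (- (1 / p))) powr q) \<partial>lebesgue) (1 / q)"
      using p1 q by (intro Hoelder_set_nn_integral) auto
    also have "(\<integral>\<^sup>+z\<in>?Q. ennreal ((?h z * \<omega> z powr (1 / p)) powr p) \<partial>lebesgue) = X"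
      unfolding X_def using p1 \<omega>0 by (simp add: powr_mult powr_powr)
    also have "(\<integral>\<^sup>+z\<in>?Q. ennreal ((\<omega> z powr (- (1 / p))) powr q) \<partial>lebesgue) = Z * ennreal N"
    proof -
      have neg: "epowr (ennreal a) (- (q / p)) = ennreal (a powr (- (q / p)))" if "0 < a" for a
        using epowr_neg[of "q / p" a] that p1 q by simp
      show ?thesis
        unfolding Z_def times_N using pos
        by (intro nn_integral_cong_AE, eventually_elim) (simp add: powr_powr neg)
    qed
    also have "epowr X (1 / p) * epowr (Z * ennreal N) (1 / q)
      = T * epowr (eavg ?Q (\<lambda>y. ennreal (\<omega> y))) (1 / p) * epowr Z (1 / q) * ennreal N"
    proof -
      have "ennreal W = eavg ?Q (\<lambda>y. ennreal (\<omega> y)) * ennreal N"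
        unfolding times_N using W(1) by (simp add: wmeasure_def)
      then have "epowr X (1 / p) = T * (epowr (eavg ?Q (\<lambda>y. ennreal (\<omega> y))) (1 / p) * epowr (ennreal N) (1 / p))"
        using p1 by (simp add: epowr_mult flip: T)
      moreover have "epowr (ennreal N) (1 / p) * epowr (ennreal N) (1 / q) = ennreal N"
        using N p1 q by (simp add: epowr_ennreal flip: ennreal_mult powr_add)
      moreover have "epowr (Z * ennreal N) (1 / q) = epowr Z (1 / q) * epowr (ennreal N) (1 / q)"
        using q by (simp add: epowr_mult)
      moreover have "T * (u * v) * (z * v') = T * u * z * (v * v')" for u v z v' :: ennreal
        by (simp add: mult_ac)
      ultimately show ?thesis by (simp only:)
    qed
    finally have "J / ennreal N \<le> T * epowr (eavg ?Q (\<lambda>y. ennreal (\<omega> y))) (1 / p) * epowr Z (1 / q)"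
      by (rule cancel)
    also have "\<dots> \<le> T * epowr (ennreal K * eavg ?B (\<lambda>y. ennreal (\<omega> y))) (1 / p)
        * epowr (ennreal K * eavg ?B (\<lambda>y. epowr (ennreal (\<omega> y)) (- q / p))) (1 / q)"
      unfolding Z_def using p1 q by (intro mult_mono epowr_mono to_ball) auto
    also have "\<dots> = T * (ennreal K * Ap_ratio p \<omega> ?B)"
    proof -
      have *: "epowr (ennreal K) (1 / p) * epowr (ennreal K) (1 / q) = ennreal K"
        using K p1 q by (simp add: epowr_ennreal flip: ennreal_mult powr_add)
      have "Ap_ratio p \<omega> ?B = epowr (eavg ?B (\<lambda>y. ennreal (\<omega> y))) (1 / p)
          * epowr (eavg ?B (\<lambda>y. epowr (ennreal (\<omega> y)) (- q / p))) (1 / q)"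
        using False by (simp add: Ap_ratio_def q_def)
      then show ?thesis
        using p1 q by (subst (2) *[symmetric]) (simp add: epowr_mult mult_ac)
    qed
    finally show ?thesis unfolding T_def .
  qed
  then show ?thesis by (simp add: eavg_def J_def N(2) K_def)
qed

section \<open>The weighted characterisation\<close>

theorem theorem3p1:
  fixes p \<theta>\<^sub>2 :: real
  assumes "3 \<le> CARD('n::finite)" and "1 \<le> p" and "0 < \<theta>\<^sub>2"
  shows
    "(\<forall>(V :: real ^ 'n \<Rightarrow> real) \<omega> C0 N0 \<eta> \<theta>\<^sub>1.
        admissible_potential V \<longrightarrow>
        Shen_constants (critical_radius V) C0 N0 \<longrightarrow>
        \<omega> \<in> Ap_class (critical_radius V) \<theta>\<^sub>2 p \<longrightarrow>
        reverse_Hoelder_exponent (critical_radius V) \<omega> \<eta> \<longrightarrow>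
        0 < \<theta>\<^sub>1 \<longrightarrow>
        (\<exists>C>0. \<forall>f \<in> BMO (critical_radius V) \<theta>\<^sub>1. \<forall>x\<^sub>0. \<forall>r>0.
           weighted_oscillation p \<omega> f (cube x\<^sub>0 r)
           \<le> ennreal (C * (1 + r / critical_radius V x\<^sub>0) powr ((N0 + 1) * \<theta>\<^sub>1 + \<eta> / p))
              * BMO_norm (critical_radius V) \<theta>\<^sub>1 f))
     \<and>
     (\<forall>C>0. \<forall>\<theta>\<^sub>1>0. \<exists>C'>0. \<forall>(V :: real ^ 'n \<Rightarrow> real) \<omega> f.
        admissible_potential V \<longrightarrow>
        \<omega> \<in> Ap_class (critical_radius V) \<theta>\<^sub>2 p \<longrightarrow>
        locally_integrable f \<longrightarrow>
        (\<forall>x\<^sub>0. \<forall>r>0.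
           weighted_oscillation p \<omega> f (cube x\<^sub>0 r)
           \<le> ennreal (C * (1 + r / critical_radius V x\<^sub>0) powr (\<theta>\<^sub>1 - \<theta>\<^sub>2))) \<longrightarrow>
        f \<in> BMO (critical_radius V) \<theta>\<^sub>1 \<and>
        BMO_norm (critical_radius V) \<theta>\<^sub>1 f
          \<le> ennreal C' * Ap_const (critical_radius V) \<theta>\<^sub>2 p \<omega>)"
proof (intro conjI allI impI)
  fix V \<omega> :: "real ^ 'n \<Rightarrow> real" and C0 N0 \<eta> \<theta>\<^sub>1 :: real
  define \<rho> where "\<rho> = critical_radius V"
  assume Shen: "Shen_constants (critical_radius V) C0 N0"
    and \<omega>: "\<omega> \<in> Ap_class (critical_radius V) \<theta>\<^sub>2 p"
    and rh: "reverse_Hoelder_exponent (critical_radius V) \<omega> \<eta>" and \<theta>: "0 < \<theta>\<^sub>1"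
  have \<rho>: "0 \<le> \<rho> x" for x by (simp add: \<rho>_def critical_radius_def)
  have w: "weight \<omega>" using \<omega> by (simp add: Ap_class_def)
  define E where "E = (N0 + 1) * \<theta>\<^sub>1 + \<eta> / p"
  obtain C where C: "0 < C" and bound: "\<And>f b x r. locally_integrable f \<Longrightarrow> 0 < b \<Longrightarrow> BMO_norm \<rho> \<theta>\<^sub>1 f \<le> ennreal b \<Longrightarrow>
      0 < r \<Longrightarrow> weighted_oscillation p \<omega> f (cube x r) \<le> ennreal (C * (1 + r / \<rho> x) powr E * b)"
    using weighted_oscillation_le_BMO_bound[OF Shen[folded \<rho>_def] \<rho> w rh[folded \<rho>_def] assms(2) \<theta>]
    unfolding E_def by blast
  have "weighted_oscillation p \<omega> f (cube x r) \<le> ennreal (C * (1 + r / \<rho> x) powr E) * BMO_norm \<rho> \<theta>\<^sub>1 f"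
    if f: "f \<in> BMO \<rho> \<theta>\<^sub>1" and r: "0 < r" for f x r
  proof -
    have "locally_integrable f" "BMO_norm \<rho> \<theta>\<^sub>1 f < \<infinity>" using f by (auto simp: BMO_def)
    then obtain b where b: "BMO_norm \<rho> \<theta>\<^sub>1 f = ennreal b" "0 \<le> b"
      by (cases "BMO_norm \<rho> \<theta>\<^sub>1 f") auto
    define D where "D = C * (1 + r / \<rho> x) powr E"
    have "0 < 1 + r / \<rho> x" using r \<rho>[of x] by (simp add: add_pos_nonneg)
    then have D: "0 < D" using C by (simp add: D_def)
    \<comment> \<open>the norm may vanish, so the bound is applied to every larger number\<close>
    have less: "weighted_oscillation p \<omega> f (cube x r) \<le> ennreal (D * (b + e / D))" if "0 < e" for e
      unfolding D_def using that b D r \<open>locally_integrable f\<close>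
      by (intro bound) (auto simp: D_def intro!: ennreal_leI add_nonneg_pos)
    have "weighted_oscillation p \<omega> f (cube x r) \<noteq> \<infinity>" using less[of 1] by (auto simp: top_unique)
    then obtain c where c: "weighted_oscillation p \<omega> f (cube x r) = ennreal c" "0 \<le> c"
      by (cases "weighted_oscillation p \<omega> f (cube x r)") auto
    have "c \<le> D * b"
    proof (rule field_le_epsilon)
      fix e :: real assume "0 < e"
      then have "c \<le> D * (b + e / D)" using less[of e] c b D by (simp add: ennreal_le_iff)
      then show "c \<le> D * b + e" using D by (simp add: distrib_left)
    qed
    then show ?thesis using b c D by (simp add: ennreal_leI flip: D_def ennreal_mult)
  qed
  with C show "\<exists>C>0. \<forall>f \<in> BMO (critical_radius V) \<theta>\<^sub>1. \<forall>x\<^sub>0. \<forall>r>0.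
           weighted_oscillation p \<omega> f (cube x\<^sub>0 r)
           \<le> ennreal (C * (1 + r / critical_radius V x\<^sub>0) powr ((N0 + 1) * \<theta>\<^sub>1 + \<eta> / p))
              * BMO_norm (critical_radius V) \<theta>\<^sub>1 f"
    unfolding \<rho>_def E_def by blast
next
  fix C \<theta>\<^sub>1 :: real
  assume C: "0 < C" and "0 < \<theta>\<^sub>1"
  define n where "n = real CARD('n)"
  have n: "1 \<le> n" by (simp add: n_def Suc_leI)
  define K where "K = real ((2 * CARD('n)) ^ CARD('n))"
  have K: "0 < K" by (simp add: K_def)
  define C' where "C' = C * (K * n powr \<theta>\<^sub>2)"
  have C': "0 < C'" using C K n by (simp add: C'_def)
  have bound: "BMO_norm \<rho> \<theta>\<^sub>1 f \<le> ennreal C' * Ap_const \<rho> \<theta>\<^sub>2 p \<omega>"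
    if \<rho>: "\<And>x. 0 \<le> \<rho> x" and \<omega>: "\<omega> \<in> Ap_class \<rho> \<theta>\<^sub>2 p" and f: "locally_integrable f"
      and osc: "\<And>x r. 0 < r \<Longrightarrow> weighted_oscillation p \<omega> f (cube x r) \<le> ennreal (C * (1 + r / \<rho> x) powr (\<theta>\<^sub>1 - \<theta>\<^sub>2))"
    for \<rho> \<omega> f :: "real ^ 'n \<Rightarrow> real"
    unfolding BMO_norm_def
  proof (intro SUP_least)
    fix x :: "real ^ 'n" and r :: real assume "r \<in> {0<..}"
    then have r: "0 < r" by simp
    define A where "A = Ap_const \<rho> \<theta>\<^sub>2 p \<omega>"
    define w where "w = 1 + r / \<rho> x"
    have w: "0 < w" using r \<rho>[of x] by (simp add: w_def add_pos_nonneg)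
    have weight: "weight \<omega>" and A: "A < \<infinity>" using \<omega> by (auto simp: A_def Ap_class_def)
    have pos: "AE y in lebesgue. 0 < \<omega> y"
      by (rule Ap_class_AE_pos[OF \<omega> assms(2) \<rho>])
    have "Ap_ratio p \<omega> (ball x (n * r)) \<le> ennreal ((1 + n * r / \<rho> x) powr \<theta>\<^sub>2) * A"
      unfolding A_def using r n \<rho> by (intro Ap_ratio_le_Ap_const) auto
    also have "\<dots> \<le> ennreal (n powr \<theta>\<^sub>2 * w powr \<theta>\<^sub>2) * A"
    proof -
      have "1 + n * r / \<rho> x \<le> n * w" using n by (simp add: w_def distrib_left)
      then have "(1 + n * r / \<rho> x) powr \<theta>\<^sub>2 \<le> (n * w) powr \<theta>\<^sub>2"
        using r n \<rho>[of x] assms(3) by (intro powr_mono2) auto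
      also have "\<dots> = n powr \<theta>\<^sub>2 * w powr \<theta>\<^sub>2" using n w by (simp add: powr_mult)
      finally show ?thesis by (intro mult_right_mono ennreal_leI) auto
    qed
    finally have ratio: "Ap_ratio p \<omega> (ball x (n * r)) \<le> ennreal (n powr \<theta>\<^sub>2 * w powr \<theta>\<^sub>2) * A" .
    then have fin: "Ap_ratio p \<omega> (ball x (n * r)) < \<infinity>"
      using A by (auto simp: ennreal_mult_less_top intro: order.strict_trans1)
    have "ennreal (w powr (- \<theta>\<^sub>1)) * eavg (cube x r) (\<lambda>y. ennreal \<bar>f y - mean (cube x r) f\<bar>)
      \<le> ennreal (w powr (- \<theta>\<^sub>1)) * (weighted_oscillation p \<omega> f (cube x r) * (ennreal K * Ap_ratio p \<omega> (ball x (n * r))))"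
      unfolding K_def n_def using fin[unfolded n_def]
      by (intro mult_left_mono oscillation_le_Ap_ratio[OF f weight pos assms(2) r]) auto
    also have "\<dots> \<le> ennreal (w powr (- \<theta>\<^sub>1)) * (ennreal (C * w powr (\<theta>\<^sub>1 - \<theta>\<^sub>2)) * (ennreal K * (ennreal (n powr \<theta>\<^sub>2 * w powr \<theta>\<^sub>2) * A)))"
      using osc[OF r, of x, folded w_def] ratio by (intro mult_mono) auto
    also have "\<dots> = ennreal (w powr (- \<theta>\<^sub>1) * (C * w powr (\<theta>\<^sub>1 - \<theta>\<^sub>2) * (K * (n powr \<theta>\<^sub>2 * w powr \<theta>\<^sub>2)))) * A"
      using C K by (simp add: ennreal_mult mult.assoc)
    also have "w powr (- \<theta>\<^sub>1) * (C * w powr (\<theta>\<^sub>1 - \<theta>\<^sub>2) * (K * (n powr \<theta>\<^sub>2 * w powr \<theta>\<^sub>2)))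
        = C' * (w powr (- \<theta>\<^sub>1 + (\<theta>\<^sub>1 - \<theta>\<^sub>2) + \<theta>\<^sub>2))"
      by (simp only: C'_def powr_add mult_ac)
    also have "\<dots> = C'" using w by simp
    finally show "ennreal ((1 + r / \<rho> x) powr (- \<theta>\<^sub>1)) * eavg (cube x r) (\<lambda>y. ennreal \<bar>f y - mean (cube x r) f\<bar>)
        \<le> ennreal C' * Ap_const \<rho> \<theta>\<^sub>2 p \<omega>"
      by (simp only: w_def A_def)
  qed
  show "\<exists>C'>0. \<forall>(V :: real ^ 'n \<Rightarrow> real) \<omega> f.
        admissible_potential V \<longrightarrow>
        \<omega> \<in> Ap_class (critical_radius V) \<theta>\<^sub>2 p \<longrightarrow>
        locally_integrable f \<longrightarrow>
        (\<forall>x\<^sub>0. \<forall>r>0.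
           weighted_oscillation p \<omega> f (cube x\<^sub>0 r)
           \<le> ennreal (C * (1 + r / critical_radius V x\<^sub>0) powr (\<theta>\<^sub>1 - \<theta>\<^sub>2))) \<longrightarrow>
        f \<in> BMO (critical_radius V) \<theta>\<^sub>1 \<and>
        BMO_norm (critical_radius V) \<theta>\<^sub>1 f
          \<le> ennreal C' * Ap_const (critical_radius V) \<theta>\<^sub>2 p \<omega>"
  proof (intro exI[of _ C'] conjI allI impI C')
    fix V \<omega> f :: "real ^ 'n \<Rightarrow> real"
    assume \<omega>: "\<omega> \<in> Ap_class (critical_radius V) \<theta>\<^sub>2 p" and f: "locally_integrable f"
    assume "\<forall>x\<^sub>0. \<forall>r>0. weighted_oscillation p \<omega> f (cube x\<^sub>0 r)
      \<le> ennreal (C * (1 + r / critical_radius V x\<^sub>0) powr (\<theta>\<^sub>1 - \<theta>\<^sub>2))"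
    then show *: "BMO_norm (critical_radius V) \<theta>\<^sub>1 f \<le> ennreal C' * Ap_const (critical_radius V) \<theta>\<^sub>2 p \<omega>"
      using \<omega> f by (intro bound) (auto simp: critical_radius_def)
    have "Ap_const (critical_radius V) \<theta>\<^sub>2 p \<omega> < \<infinity>" using \<omega> by (simp add: Ap_class_def)
    with * have "BMO_norm (critical_radius V) \<theta>\<^sub>1 f < \<infinity>"
      by (auto simp: ennreal_mult_less_top intro: order.strict_trans1)
    with f show "f \<in> BMO (critical_radius V) \<theta>\<^sub>1" by (simp add: BMO_def)
  qed
qed

end
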